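(* Let $H\in\mathbb{A}$ be a nonzero polynomial of degree $m$, let $l\ge 1$ and $s\ge 0$ be integers. Let $\chi$ be a Dirichlet character modulo $H$ with conductor $D$, and let $\psi$ be the primitive character modulo $D$ that induces $\chi$. For $1\le i\le s$ let $W_i\in\mathbb{A}$ with $\deg W_i<\deg H$ and let $\lambda_i=E(W_i,H)$ be the corresponding additive character modulo $H$. Let $S\in\mathbb{A}$ with $(S,H)=1$, and let $F$ be any arithmetical function on $\mathbb{A}$. Let $H_0$ be the monic divisor of $H$ whose irreducible factors are exactly those of $D$ and such that $(H_0,H/H_0)=1$. Then \begin{multline*} \sum_{\substack{ K_1,\ldots, K_l, B_1,\ldots, B_s \pmod{H}\\(K_1+\cdots+K_l, H)=1\\ (K_1\cdots K_l, H)=1}} F\big((K_1+\cdots+K_l-S,B_1,\ldots, B_s,H)\big)\chi(K_1) \lambda_1(B_1) \cdots \lambda_s(B_s)\\ = \mu(D)^{l-1} \; \psi(S) \; \varphi\left( \frac{H_0^l}{D^{l-1}}\right) \varphi_l \left( \frac{H}{H_0}\right) \sum_{\substack{D\mid M \mid H \\ \frac{H}{M} \mid W_1, \ldots, \frac{H}{M}\mid W_s}}\frac{ (\mu \ast F)(M) }{ \varphi(M)} \left|\frac{H}{M}\right|^s, \end{multline*} where the sum on the left is over all residue classes $K_1,\dots,K_l,B_1,\dots,B_s$ modulo $H$ and the sum on the right is over monic $M$ with $D\mid M\mid H$.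
   Context: $\mathbb{F}_q$ is a finite field with $q$ elements, $q$ a power of a prime $p$, $Tr:\mathbb{F}_q\to\mathbb{F}_p$ the trace map, and $\mathbb{A}=\mathbb{F}_q[T]$. For nonzero $A$, $|A|=q^{\deg A}$. $(A_1,\dots,A_k)$ denotes the monic gcd. Divisors in sums and products are monic; $P$ denotes monic irreducible polynomials. Möbius function: $\mu(A)=1$ if $A\in\mathbb{F}_q^*$, $\mu(A)=(-1)^t$ if $A$ is a product of $t$ distinct monic irreducibles, and $0$ otherwise. Euler function: $\varphi(H)=|H|\prod_{P\mid H}(1-1/|P|)$. For $k\ge1$, $\varphi_k(H)$ is the number of $k$-tuples $(H_1,\dots,H_k)$ of residue classes modulo $H$ with $(H_1\cdots H_k,H)=1$ and $(H_1+\cdots+H_k,H)=1$. An arithmetical function is a function $F:\mathbb{A}\setminus\{0\}\to\mathbb{C}$ (only its values on monic polynomials enter here). Dirichlet convolution: $(f\ast g)(H)=\sum_{D\mid H}f(D)g(H/D)$, over monic divisors. A Dirichlet character modulo $H$ is $\chi:\mathbb{A}\to\mathbb{C}$ with $\chi(A+KH)=\chi(A)$, $\chi(A_1A_2)=\chi(A_1)\chi(A_2)$, and $\chi(A)\ne0\iff(A,H)=1$. A monic divisor $D$ of $H$ is an induced modulus for $\chi$ if $\chi(A)=\chi(B)$ whenever $A\equiv B\pmod D$ (with $A,B$ coprime to $H$); the conductor is the unique induced modulus dividing all induced moduli. $\chi$ is primitive modulo $H$ if its only induced modulus is $H$; if $\chi$ has conductor $D$ there is a unique primitive character $\psi$ modulo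 $D$ with $\chi(A)=\psi(A)$ for all $A$ coprime to $H$. Additive characters: for $\deg H=m$ and $B\in\mathbb{A}$ with $B\equiv b_{m-1}T^{m-1}+\cdots+b_0\pmod H$, set $t(B)=b_{m-1}$; for $G\in\mathbb{A}$, $E(G,H)(B)=\exp\big(\tfrac{2\pi i}{p}Tr(t(GB))\big)$. *)

theory Defs
  imports
    Complex_Main
    "HOL-Library.FuncSet"
    "HOL-Library.Cardinality"
    "HOL-Computational_Algebra.Computational_Algebra"
    "HOL-Number_Theory.Cong"
begin

text \<open>
  The ring \<open>\<bbbA> = \<bbbF>\<^sub>q[T]\<close> is the type \<^typ>\<open>'a poly\<close> with coefficients in a finite field, \<open>q = CARD('a)\<close>
  and \<open>p = CHAR('a)\<close>.  Where a greatest common divisor is needed the coefficients have sort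
  \<open>{finite_field, field_gcd}\<close>.  Every field can be given this structure, and necessarily
  \<^const>\<open>unit_factor\<close> is then the identity, so that \<^const>\<open>normalize\<close>, \<^const>\<open>gcd\<close> and
  \<^const>\<open>Gcd\<close> on polynomials return monic polynomials (or 0).
\<close>

text \<open>Only meaningful for nonzero polynomials: \<^term>\<open>degree 0 = 0\<close> makes the norm of 0 equal to 1.\<close>
definition poly_norm :: "'a::finite_field poly \<Rightarrow> real" where
  "poly_norm A = real CARD('a) ^ degree A"

definition monic_irreducible_divisors :: "'a::finite_field poly \<Rightarrow> 'a poly set" where
  "monic_irreducible_divisors A = {P. lead_coeff P = 1 \<and> irreducible P \<and> P dvd A}"

text \<open>
  If \<open>A\<close> is the product of a set \<open>X\<close> of monic irreducibles, then \<open>X\<close> is the set of all monic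
  irreducible divisors of \<open>A\<close>; see \<open>moebius_prod\<close>.
\<close>
definition moebius :: "'a::finite_field poly \<Rightarrow> complex" where
  "moebius A =
     (if is_unit A then 1
      else if \<exists>X. finite X \<and> (\<forall>P\<in>X. lead_coeff P = 1 \<and> irreducible P) \<and> A = \<Prod>X
      then (-1) ^ card (monic_irreducible_divisors A)
      else 0)"

definition euler_phi :: "'a::finite_field poly \<Rightarrow> real" where
  "euler_phi H = poly_norm H * (\<Prod>P\<in>monic_irreducible_divisors H. 1 - 1 / poly_norm P)"

text \<open>The canonical representatives of the residue classes modulo a nonzero polynomial.\<close>
definition residue_reps :: "'a::finite_field poly \<Rightarrow> 'a poly set" where
  "residue_reps H = {A. A mod H = A}"

definition euler_phi_tuples :: "nat \<Rightarrow> 'a::finite_field poly \<Rightarrow> nat" where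
  "euler_phi_tuples k H =
     card {K \<in> {1..k} \<rightarrow>\<^sub>E residue_reps H.
             coprime (\<Prod>i=1..k. K i) H \<and> coprime (\<Sum>i=1..k. K i) H}"

definition dirichlet_conv ::
  "('a::finite_field poly \<Rightarrow> complex) \<Rightarrow> ('a poly \<Rightarrow> complex) \<Rightarrow> 'a poly \<Rightarrow> complex" where
  "dirichlet_conv f g H = (\<Sum>D | lead_coeff D = 1 \<and> D dvd H. f D * g (H div D))"

definition dirichlet_character :: "'a::finite_field poly \<Rightarrow> ('a poly \<Rightarrow> complex) \<Rightarrow> bool" where
  "dirichlet_character H \<chi> \<longleftrightarrow>
     (\<forall>A K. \<chi> (A + K * H) = \<chi> A) \<and>
     (\<forall>A B. \<chi> (A * B) = \<chi> A * \<chi> B) \<and>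
     (\<forall>A. \<chi> A \<noteq> 0 \<longleftrightarrow> coprime A H)"

definition induced_modulus ::
  "'a::finite_field poly \<Rightarrow> ('a poly \<Rightarrow> complex) \<Rightarrow> 'a poly \<Rightarrow> bool" where
  "induced_modulus H \<chi> D \<longleftrightarrow>
     lead_coeff D = 1 \<and> D dvd H \<and>
     (\<forall>A B. coprime A H \<longrightarrow> coprime B H \<longrightarrow> [A = B] (mod D) \<longrightarrow> \<chi> A = \<chi> B)"

definition is_conductor ::
  "'a::finite_field poly \<Rightarrow> ('a poly \<Rightarrow> complex) \<Rightarrow> 'a poly \<Rightarrow> bool" where
  "is_conductor H \<chi> D \<longleftrightarrow>
     induced_modulus H \<chi> D \<and> (\<forall>D'. induced_modulus H \<chi> D' \<longrightarrow> D dvd D')"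

text \<open>Induced moduli are monic, hence the normalization of the modulus.\<close>
definition primitive_character ::
  "'a::{finite_field,field_gcd} poly \<Rightarrow> ('a poly \<Rightarrow> complex) \<Rightarrow> bool" where
  "primitive_character H \<chi> \<longleftrightarrow>
     dirichlet_character H \<chi> \<and> (\<forall>D. induced_modulus H \<chi> D \<longleftrightarrow> D = normalize H)"

text \<open>
  The trace to the prime field is the sum of the conjugates \<open>x\<^bsup>p^j\<^esup>\<close> for \<open>j < n\<close>, where \<open>q = p\<^sup>n\<close>.
  Its value is an element of \<^typ>\<open>'a\<close> in the image of \<^const>\<open>of_nat\<close>, and
  \<open>prime_field_rep\<close> picks the representative in \<open>{0..<p}\<close>.
\<close>
definition field_trace :: "'a::finite_field \<Rightarrow> 'a" where
  "field_trace x = (\<Sum>j < (THE n. CARD('a) = CHAR('a) ^ n). x ^ (CHAR('a) ^ j))"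

definition prime_field_rep :: "'a::finite_field \<Rightarrow> nat" where
  "prime_field_rep y = (THE k. k < CHAR('a) \<and> of_nat k = y)"

text \<open>For constant \<open>H\<close> the remainder is 0, so the coefficient at the truncated index is 0 as well.\<close>
definition top_residue_coeff :: "'a::finite_field poly \<Rightarrow> 'a poly \<Rightarrow> 'a" where
  "top_residue_coeff H B = coeff (B mod H) (degree H - 1)"

definition additive_character ::
  "'a::finite_field poly \<Rightarrow> 'a poly \<Rightarrow> 'a poly \<Rightarrow> complex" where
  "additive_character G H B =
     exp (2 * of_real pi * \<i> / of_nat CHAR('a) *
          of_nat (prime_field_rep (field_trace (top_residue_coeff H (G * B)))))"


lemma residue_reps_altdef:
  assumes "H \<noteq> 0"
  shows "residue_reps H = {A. A = 0 \<or> degree A < degree H}"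
  using assms degree_mod_less[of H] mod_poly_less
  by (auto simp: residue_reps_def) metis

lemma moebius_prod:
  fixes X :: "'a::finite_field poly set"
  assumes "finite X" "\<And>P. P \<in> X \<Longrightarrow> lead_coeff P = 1 \<and> irreducible P"
  shows "monic_irreducible_divisors (\<Prod>X) = X" and "moebius (\<Prod>X) = (-1) ^ card X"
proof -
  show *: "monic_irreducible_divisors (\<Prod>X) = X"
  proof (intro equalityI subsetI)
    fix P assume "P \<in> monic_irreducible_divisors (\<Prod>X)"
    hence P: "lead_coeff P = 1" "irreducible P" "P dvd \<Prod>X"
      by (auto simp: monic_irreducible_divisors_def)
    have "prime_elem P"
      using P by (intro field_poly_irreducible_imp_prime)
    have "\<exists>Q\<in>X. P dvd Q"
      using assms(1) P(3)
    proof (induction X rule: finite_induct)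
      case empty
      thus ?case using P(2) by (simp add: irreducible_def)
    next
      case (insert Q X)
      thus ?case using \<open>prime_elem P\<close> by (auto simp: prime_elem_dvd_mult_iff)
    qed
    then obtain Q where Q: "Q \<in> X" "P dvd Q" by blast
    then obtain R where R: "Q = P * R" by (elim dvdE)
    have "is_unit R"
      using R assms(2)[OF Q(1)] P(2) by (auto dest: irreducibleD simp: irreducible_def)
    then obtain c where c: "R = [:c:]"
      by (auto simp: is_unit_poly_iff)
    have "lead_coeff Q = c"
      unfolding R c using P(1) by (simp add: lead_coeff_mult)
    hence "c = 1" using assms(2)[OF Q(1)] by simp
    thus "P \<in> X" using Q R c by simp
  next
    fix P assume "P \<in> X"
    thus "P \<in> monic_irreducible_divisors (\<Prod>X)"
      using assms by (auto simp: monic_irreducible_divisors_def intro: dvd_prodI)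
  qed
  show "moebius (\<Prod>X) = (-1) ^ card X"
  proof (cases "X = {}")
    case False
    then obtain P where "P \<in> X" by blast
    hence "P dvd \<Prod>X" "\<not>is_unit P"
      using assms by (auto simp: irreducible_def intro: dvd_prodI)
    hence "\<not>is_unit (\<Prod>X)"
      using dvd_trans by blast
    moreover have "\<exists>Y. finite Y \<and> (\<forall>P\<in>Y. lead_coeff P = 1 \<and> irreducible P) \<and> \<Prod>X = \<Prod>Y"
      using assms by (intro exI[of _ X]) auto
    ultimately show ?thesis
      using * by (simp add: moebius_def)
  qed (simp add: moebius_def)
qed

lemma of_nat_inj_CHAR:
  assumes "i < CHAR('a)" "j < CHAR('a)" "of_nat i = (of_nat j :: 'a::finite_field)"
  shows "i = j"
proof -
  have "[i = j] (mod CHAR('a))" using assms(3) by (simp add: of_nat_eq_iff_cong_CHAR)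
  thus ?thesis using assms by (simp add: cong_def)
qed

lemma card_finite_field: "\<exists>!n. CARD('a::finite_field) = CHAR('a) ^ n"
proof -
  let ?p = "CHAR('a)"
  have p: "prime ?p" by simp
  hence p1: "?p > 1" by (rule prime_gt_1_nat)
  define Q where "Q = (\<lambda>X :: 'a set. 0 \<in> X \<and> (\<forall>x\<in>X. \<forall>y\<in>X. x - y \<in> X) \<and> (\<exists>n. card X = ?p ^ n))"
  have "Q {0}" by (auto simp: Q_def intro: exI[of _ 0])
  define X where "X = (ARG_MAX card X. Q X)"
  have fin: "\<forall>X. Q X \<longrightarrow> card X < Suc CARD('a)"
    by (auto simp: less_Suc_eq_le card_mono)
  have QX: "Q X" and mx: "\<And>Y. Q Y \<Longrightarrow> card Y \<le> card X"
    using arg_max_nat_lemma[of Q "{0}" card "Suc CARD('a)"] \<open>Q {0}\<close> fin unfolding X_def by auto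
  have X0: "0 \<in> X" and Xd: "\<And>x y. x \<in> X \<Longrightarrow> y \<in> X \<Longrightarrow> x - y \<in> X"
    using QX by (auto simp: Q_def)
  have Xm: "- x \<in> X" if "x \<in> X" for x using Xd[OF X0 that] by simp
  have Xa: "x + y \<in> X" if "x \<in> X" "y \<in> X" for x y
    using Xd[OF that(1) Xm[OF that(2)]] by simp
  have Xn: "of_nat k * x \<in> X" if "x \<in> X" for k x
    by (induction k) (auto simp: X0 Xa that algebra_simps)
  have "X = UNIV"
  proof (rule ccontr)
    assume "X \<noteq> UNIV"
    then obtain z where z: "z \<notin> X" by blast
    define f where "f = (\<lambda>(k::nat, x). of_nat k * z + x)"
    define Y where "Y = f ` ({..<?p} \<times> X)"
    have mem: "k = 0" if "k < ?p" "of_nat k * z \<in> X" for k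
    proof (rule ccontr)
      assume "k \<noteq> 0"
      hence "coprime k ?p" using p that(1)
        by (metis coprime_commute nat_dvd_not_less neq0_conv prime_imp_coprime_nat)
      then obtain m where "[k * m = 1] (mod ?p)"
        using cong_solve_coprime_nat by (metis One_nat_def)
      hence "of_nat (k * m) = (of_nat 1 :: 'a)" by (simp only: of_nat_eq_iff_cong_CHAR)
      hence "of_nat m * (of_nat k * z) = z" 
        by (metis mult.assoc mult.commute mult_1 of_nat_1 of_nat_mult)
      with Xn[OF that(2), of m] z show False by simp
    qed
    have inj1: "k = k'" if "k \<le> k'" "k' < ?p" "x \<in> X" "x' \<in> X" "of_nat k * z + x = of_nat k' * z + x'" 
      for k k' x x'
    proof -
      have "of_nat (k' - k) * z = x - x'" using that by (simp add: algebra_simps of_nat_diff)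
      hence "k' - k = 0" using that by (intro mem) (auto simp: Xd)
      thus ?thesis using that by simp
    qed
    have "inj_on f ({..<?p} \<times> X)"
    proof (rule inj_onI)
      fix u v assume a: "u \<in> {..<?p} \<times> X" "v \<in> {..<?p} \<times> X" "f u = f v"
      obtain k x k' x' where uv: "u = (k, x)" "v = (k', x')" by (cases u, cases v)
      have e: "of_nat k * z + x = of_nat k' * z + x'" using a(3) by (simp add: uv f_def)
      have "k = k'"
      proof (cases "k \<le> k'")
        case True thus ?thesis using inj1[of k k' x x'] a e by (simp add: uv)
      next
        case False thus ?thesis using inj1[of k' k x' x] a e by (simp add: uv)
      qed
      thus "u = v" using e by (simp add: uv)
    qed
    hence cY: "card Y = ?p * card X" by (simp add: Y_def card_image card_cartesian_product)
    have Yall: "of_nat k * z + x \<in> Y" if "x \<in> X" for k x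
    proof -
      have "(of_nat k :: 'a) = of_nat (k mod ?p)" by (simp add: of_nat_eq_iff_cong_CHAR cong_def)
      hence "of_nat k * z + x = f (k mod ?p, x)" by (simp add: f_def)
      thus ?thesis using that p1 by (auto simp: Y_def)
    qed
    have "Q Y" unfolding Q_def
    proof (intro conjI ballI)
      show "0 \<in> Y" using Yall[OF X0, of 0] by simp
      show "\<exists>n. card Y = ?p ^ n" using QX cY by (auto simp: Q_def intro: exI[of _ "Suc _"])
      fix a b assume "a \<in> Y" "b \<in> Y"
      then obtain k x k' x' where *: "k < ?p" "k' < ?p" "x \<in> X" "x' \<in> X"
        "a = of_nat k * z + x" "b = of_nat k' * z + x'" by (auto simp: Y_def f_def)
      have "a - b = of_nat (k + (?p - k')) * z + (x - x')"
        using *(2) by (simp add: *(5,6) algebra_simps of_nat_diff)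
      thus "a - b \<in> Y" using Yall[OF Xd[OF *(3,4)]] by metis
    qed
    from mx[OF this] have "?p * card X \<le> card X" by (simp add: cY)
    moreover have "card X > 0" using X0 by (auto simp: card_gt_0_iff)
    ultimately show False using p1 by simp
  qed
  hence "\<exists>n. CARD('a) = ?p ^ n" using QX by (auto simp: Q_def)
  thus ?thesis using p1 by (metis power_inject_exp)
qed

lemma prime_field_rep_field_trace:
  fixes x :: "'a::finite_field"
  shows "\<exists>!k. k < CHAR('a) \<and> of_nat k = field_trace x"
proof -
  let ?p = "CHAR('a)"
  have p: "prime ?p" by simp
  hence p1: "?p > 1" by (rule prime_gt_1_nat)
  define n where "n = (THE n. CARD('a) = ?p ^ n)"
  have n: "CARD('a) = ?p ^ n" unfolding n_def by (rule theI'[OF card_finite_field])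
  have "field_trace x ^ ?p = (\<Sum>j<n. (x ^ (?p ^ j)) ^ ?p)"
    unfolding field_trace_def n_def[symmetric] by (rule freshmans_dream_sum) auto
  also have "\<dots> = (\<Sum>j<n. x ^ (?p ^ Suc j))"
    by (simp add: mult_ac flip: power_mult)
  also have "\<dots> = (\<Sum>j<Suc n. x ^ (?p ^ j)) - x"
    by (subst sum.lessThan_Suc_shift) simp
  also have "\<dots> = field_trace x"
    using finite_field_power_card_eq_same[of x] unfolding field_trace_def n_def[symmetric]
    by (simp flip: n)
  finally have tr: "field_trace x ^ ?p = field_trace x" .
  define f where "f = monom (1::'a) ?p - monom 1 1"
  have ev: "poly f y = y ^ ?p - y" for y by (simp add: f_def poly_monom)
  have dg: "degree f = ?p"
    unfolding f_def using p1 degree_add_eq_left[of "- monom 1 1" "monom (1::'a) ?p"] by (simp add: degree_monom_eq)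
  have f0: "f \<noteq> 0" using dg p1 by auto
  have sub: "of_nat ` {..<?p} \<subseteq> {y. poly f y = 0}"
  proof safe
    fix k
    have "(of_nat k :: 'a) ^ ?p = of_nat k"
    proof (induction k)
      case (Suc k)
      have "(1 + of_nat k :: 'a) ^ ?p = 1 ^ ?p + of_nat k ^ ?p"
        by (rule freshmans_dream) auto
      thus ?case using Suc by simp
    qed (use p1 in auto)
    thus "poly f (of_nat k) = 0" by (simp add: ev)
  qed
  have "card {y. poly f y = 0} \<le> card (of_nat ` {..<?p} :: 'a set)"
  proof -
    have "inj_on (of_nat :: nat \<Rightarrow> 'a) {..<?p}"
      by (auto intro: inj_onI of_nat_inj_CHAR)
    thus ?thesis using card_poly_roots_bound[OF f0] dg by (simp add: card_image)
  qed
  hence "of_nat ` {..<?p} = {y. poly f y = 0}"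
    using sub by (intro card_seteq) auto
  hence "field_trace x \<in> of_nat ` {..<?p}" using tr by (auto simp: ev)
  thus ?thesis using of_nat_inj_CHAR[where ?'a = 'a] by auto
qed

end

theory Submission
  imports Defs
begin

text \<open>
  Put \<open>J(A) = \<Sum> \<chi>(K\<^sub>1)\<close>, summed over the unit tuples with \<open>K\<^sub>1 + \<dots> + K\<^sub>l = A\<close>.  Write \<open>H = H\<^sub>0 H\<^sub>1\<close>.  The
  Chinese remainder theorem splits \<open>J\<close> into a factor modulo \<open>H\<^sub>0\<close>, which carries the character, and a
  counting factor modulo \<open>H\<^sub>1\<close>.  Modulo \<open>H\<^sub>0\<close>, convolving \<open>\<psi>\<close> with the indicator function of the units
  multiplies it by \<open>\<mu>(D) |H\<^sub>0/D|\<close>, because \<open>\<psi>\<close> sums to zero over residue classes modulo \<open>E\<close> unless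
  \<open>D dvd E\<close>.  Modulo \<open>H\<^sub>1\<close>, scaling shows that the count is constant on units, hence equal to
  \<open>\<phi>\<^sub>l(H\<^sub>1) / \<phi>(H\<^sub>1)\<close>.  So on units \<open>J\<close> is a constant multiple of \<open>\<chi>\<close>.  Expanding \<open>F\<close> at the gcd as a
  sum of \<open>\<mu> * F\<close> over the common divisors \<open>M\<close>, the additive variables contribute \<open>|H/M|\<close> each if
  \<open>H/M\<close> divides all \<open>W\<^sub>i\<close> and nothing otherwise, and the sum of \<open>\<chi>\<close> over the class of \<open>S\<close> modulo \<open>M\<close>
  is \<open>\<psi>(S) \<phi>(H) / \<phi>(M)\<close> if \<open>D dvd M\<close> and 0 otherwise.
\<close>

subsection \<open>Sums over residue classes\<close>

text \<open>Residue classes are handled through representatives rather than a quotient type: a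
  function on classes is a function on polynomials with this property, and it is summed over
  \<open>residue_reps H\<close>.\<close>

definition periodic_mod :: "'a::finite_field poly \<Rightarrow> ('a poly \<Rightarrow> 'b) \<Rightarrow> bool" where
  "periodic_mod H f \<longleftrightarrow> (\<forall>A B. [A = B] (mod H) \<longrightarrow> f A = f B)"

lemma periodic_modI: "(\<And>A B. [A = B] (mod H) \<Longrightarrow> f A = f B) \<Longrightarrow> periodic_mod H f"
  by (auto simp: periodic_mod_def)

lemma periodic_modD: "periodic_mod H f \<Longrightarrow> [A = B] (mod H) \<Longrightarrow> f A = f B"
  by (auto simp: periodic_mod_def)

lemma periodic_mod_mod: "periodic_mod H f \<Longrightarrow> f (A mod H) = f A"
  by (erule periodic_modD) simp

lemma periodic_mod_dvd: "periodic_mod M f \<Longrightarrow> M dvd H \<Longrightarrow> periodic_mod H f"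
  by (auto simp: periodic_mod_def intro: cong_dvd_modulus)

lemma periodic_mod_mult:
  fixes f g :: "'a::finite_field poly \<Rightarrow> complex"
  assumes "periodic_mod H f" "periodic_mod H g"
  shows   "periodic_mod H (\<lambda>A. f A * g A)"
  by (intro periodic_modI arg_cong2[of _ _ _ _ "(*)"] periodic_modD[OF assms(1)] periodic_modD[OF assms(2)])

lemma periodic_mod_reflect: "periodic_mod H f \<Longrightarrow> periodic_mod H (\<lambda>A. f (B - A))"
  by (rule periodic_modI, erule periodic_modD) (auto intro: cong_diff)

lemma periodic_mod_translate: "periodic_mod H f \<Longrightarrow> periodic_mod H (\<lambda>A. f (A - B))"
  by (rule periodic_modI, erule periodic_modD) (auto intro: cong_diff)

section \<open>The number of residue classes\<close>

lemma finite_polys_below: "finite {p :: 'a::finite_field poly. \<forall>i\<ge>n. coeff p i = 0}"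
  and card_polys_below: "card {p :: 'a poly. \<forall>i\<ge>n. coeff p i = 0} = CARD('a) ^ n"
proof -
  have "finite {p :: 'a poly. \<forall>i\<ge>n. coeff p i = 0} \<and>
        card {p :: 'a poly. \<forall>i\<ge>n. coeff p i = 0} = CARD('a) ^ n"
  proof (induction n)
    case 0
    have "{p :: 'a poly. \<forall>i\<ge>0. coeff p i = 0} = {0}"
      by (auto simp: poly_eq_iff)
    thus ?case by simp
  next
    case (Suc n)
    \<comment> \<open>Splitting off the constant coefficient lowers the bound by one. The bound is
      put on coefficients so that the zero polynomial and \<open>n = 0\<close> need no separate
      treatment.\<close>
    have eq: "{p :: 'a poly. \<forall>i\<ge>Suc n. coeff p i = 0} =
          (\<lambda>(a, p). pCons a p) ` (UNIV \<times> {p. \<forall>i\<ge>n. coeff p i = 0})"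
    proof (intro equalityI subsetI)
      fix p :: "'a poly" assume p: "p \<in> {p. \<forall>i\<ge>Suc n. coeff p i = 0}"
      obtain a q where pq: "p = pCons a q" by (cases p) auto
      have "coeff q i = 0" if "i \<ge> n" for i
        using p that by (auto simp: pq dest: spec[of _ "Suc i"])
      thus "p \<in> (\<lambda>(a, p). pCons a p) ` (UNIV \<times> {p. \<forall>i\<ge>n. coeff p i = 0})"
        by (auto simp: pq)
    qed (auto simp: coeff_pCons split: nat.splits)
    have "inj_on (\<lambda>(a, p). pCons a p) (UNIV \<times> {p :: 'a poly. \<forall>i\<ge>n. coeff p i = 0})"
      by (auto intro: inj_onI)
    thus ?case using Suc unfolding eq
      by (simp add: card_image card_cartesian_product)
  qed
  thus "finite {p :: 'a poly. \<forall>i\<ge>n. coeff p i = 0}"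
       "card {p :: 'a poly. \<forall>i\<ge>n. coeff p i = 0} = CARD('a) ^ n" by auto
qed

lemma residue_reps_coeffs:
  fixes H :: "'a::finite_field poly"
  assumes "H \<noteq> 0"
  shows   "residue_reps H = {p. \<forall>i\<ge>degree H. coeff p i = 0}"
  unfolding residue_reps_altdef[OF assms]
  by (auto simp: coeff_eq_0) (metis leading_coeff_0_iff not_le)

lemma finite_residue_reps [simp]:
  fixes H :: "'a::finite_field poly"
  shows "H \<noteq> 0 \<Longrightarrow> finite (residue_reps H)"
  by (simp add: residue_reps_coeffs finite_polys_below)

lemma card_residue_reps:
  fixes H :: "'a::finite_field poly"
  shows "H \<noteq> 0 \<Longrightarrow> real (card (residue_reps H)) = poly_norm H"
  by (simp add: residue_reps_coeffs card_polys_below poly_norm_def)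

lemma mod_in_residue_reps [simp]: "A mod H \<in> residue_reps H"
  by (simp add: residue_reps_def)

text \<open>The maps \<open>g\<close> and \<open>h\<close> are inverse to each other only up to
  congruence; reducing their values modulo \<open>H\<close> makes them inverse permutations of the
  representatives.\<close>

lemma sum_residue_reps_bij:
  fixes f :: "'a::finite_field poly \<Rightarrow> complex"
  assumes f: "periodic_mod H f"
    and "\<And>A B. [A = B] (mod H) \<Longrightarrow> [g A = g B] (mod H)"
    and "\<And>A B. [A = B] (mod H) \<Longrightarrow> [h A = h B] (mod H)"
    and "\<And>A. [h (g A) = A] (mod H)" "\<And>A. [g (h A) = A] (mod H)"
  shows "(\<Sum>A\<in>residue_reps H. f (g A)) = (\<Sum>A\<in>residue_reps H. f A)"
proof (rule sum.reindex_bij_witness[where i = "\<lambda>A. h A mod H" and j = "\<lambda>A. g A mod H"])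
  fix A assume A: "A \<in> residue_reps H"
  have "[h (g A mod H) = h (g A)] (mod H)" by (rule assms) simp
  also have "[h (g A) = A] (mod H)" by fact
  finally show "h (g A mod H) mod H = A" using A by (simp add: cong_def residue_reps_def)
  have "[g (h A mod H) = g (h A)] (mod H)" by (rule assms) simp
  also have "[g (h A) = A] (mod H)" by fact
  finally show "g (h A mod H) mod H = A" using A by (simp add: cong_def residue_reps_def)
  show "f (g A mod H) = f (g A)" using f by (simp add: periodic_mod_mod)
qed auto

lemma sum_residue_reps_translate:
  fixes f :: "'a::finite_field poly \<Rightarrow> complex"
  assumes "periodic_mod H f"
  shows "(\<Sum>A\<in>residue_reps H. f (A + B)) = (\<Sum>A\<in>residue_reps H. f A)"
  by (rule sum_residue_reps_bij[OF assms, of _ "\<lambda>A. A - B"]) (auto intro: cong_add cong_diff)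

lemma sum_residue_reps_reflect:
  fixes f :: "'a::finite_field poly \<Rightarrow> complex"
  assumes "periodic_mod H f"
  shows "(\<Sum>A\<in>residue_reps H. f (B - A)) = (\<Sum>A\<in>residue_reps H. f A)"
  by (rule sum_residue_reps_bij[OF assms, of _ "\<lambda>A. B - A"]) (auto intro: cong_diff)

lemma coprime_imp_inverse_mod:
  fixes A H :: "'a::{finite_field,field_gcd} poly"
  assumes "coprime A H"
  obtains V where "[A * V = 1] (mod H)" "coprime V H"
proof -
  obtain V y where "bezout_coefficients A H = (V, y)" by fastforce
  hence "V * A + y * H = 1"
    using assms by (simp add: bezout_coefficients)
  hence V: "A * V - 1 = - y * H" by (simp add: algebra_simps)
  have "[A * V = 1] (mod H)" unfolding cong_iff_dvd_diff V by simp
  moreover from this have "coprime (A * V) H"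
    by (metis cong_imp_coprime cong_sym coprime_1_left)
  ultimately show ?thesis using that by simp
qed

lemma sum_residue_reps_scale:
  fixes f :: "'a::{finite_field,field_gcd} poly \<Rightarrow> complex"
  assumes "periodic_mod H f" "coprime U H"
  shows "(\<Sum>A\<in>residue_reps H. f (U * A)) = (\<Sum>A\<in>residue_reps H. f A)"
proof -
  obtain V where V: "[U * V = 1] (mod H)"
    using assms(2) by (rule coprime_imp_inverse_mod)
  have "[V * (U * A) = A] (mod H)" "[U * (V * A) = A] (mod H)" for A
    using cong_scalar_right[OF V, of A] by (simp_all add: mult_ac)
  thus ?thesis
    by (intro sum_residue_reps_bij[OF assms(1), of _ "\<lambda>A. V * A"]) (auto intro: cong_scalar_left)
qed

text \<open>Division with remainder by \<open>M\<close> writes each representative modulo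
  \<open>M * E\<close> uniquely as \<open>A + M * C\<close>, and comparing degrees shows that the
  quotient \<open>C\<close> is a representative modulo \<open>E\<close>.\<close>

lemma sum_residue_reps_mult:
  fixes f :: "'a::finite_field poly \<Rightarrow> complex"
  assumes f: "periodic_mod (M * E) f" and nz: "M \<noteq> 0" "E \<noteq> 0"
  shows "(\<Sum>A\<in>residue_reps (M * E). f A) =
         (\<Sum>A\<in>residue_reps M. \<Sum>C\<in>residue_reps E. f (A + M * C))"
proof -
  have lt: "A + M * C \<in> residue_reps (M * E)" if "A \<in> residue_reps M" "C \<in> residue_reps E" for A C
  proof (cases "C = 0")
    case True
    thus ?thesis using that nz by (auto simp: residue_reps_altdef degree_mult_eq)
  next
    case False
    hence "degree (M * C) < degree M + degree E" using that nz
      by (auto simp: residue_reps_altdef degree_mult_eq)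
    moreover have "degree A < degree M + degree E"
      using that nz False by (auto simp: residue_reps_altdef)
    ultimately show ?thesis
      using nz by (auto simp: residue_reps_altdef degree_mult_eq intro: degree_add_less)
  qed
  have dv: "(A + M * C) mod M = A" "(A + M * C) div M = C" if "A \<in> residue_reps M" for A C
    using that nz by (auto simp: residue_reps_altdef div_poly_less mod_poly_less)
  have "(\<Sum>A\<in>residue_reps M. \<Sum>C\<in>residue_reps E. f (A + M * C)) =
        (\<Sum>(A, C)\<in>residue_reps M \<times> residue_reps E. f (A + M * C))"
    by (simp add: sum.cartesian_product)
  also have "\<dots> = (\<Sum>A\<in>residue_reps (M * E). f A)"
  proof (rule sum.reindex_bij_witness[where i = "\<lambda>A. (A mod M, A div M)" and j = "\<lambda>(A, C). A + M * C"])
    fix A assume A: "A \<in> residue_reps (M * E)"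
    show "(case (A mod M, A div M) of (A, C) \<Rightarrow> A + M * C) = A" by simp
    have "A div M \<in> residue_reps E"
    proof (cases "A div M = 0")
      case False
      hence "A \<noteq> 0" by auto
      hence "degree A < degree M + degree E"
        using A nz by (auto simp: residue_reps_altdef degree_mult_eq)
      moreover have "degree (A mod M) < degree M + degree E"
        using degree_mod_less[OF nz(1), of A] calculation by auto
      ultimately have "degree (A - A mod M) < degree M + degree E"
        by (rule degree_diff_less)
      also have "A - A mod M = M * (A div M)" by (simp add: minus_mod_eq_mult_div)
      finally show ?thesis using nz False by (simp add: degree_mult_eq residue_reps_altdef)
    qed (simp add: residue_reps_def)
    thus "(A mod M, A div M) \<in> residue_reps M \<times> residue_reps E" by simp
  qed (use lt dv in auto)
  finally show ?thesis ..
qed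

lemma sum_residue_reps_periodic_dvd:
  fixes f :: "'a::finite_field poly \<Rightarrow> complex"
  assumes "periodic_mod M f" "M dvd H" "H \<noteq> 0"
  shows "(\<Sum>A\<in>residue_reps H. f A) = of_real (poly_norm (H div M)) * (\<Sum>A\<in>residue_reps M. f A)"
proof -
  obtain E where E: "H = M * E" using assms(2) by (elim dvdE)
  have nz: "M \<noteq> 0" "E \<noteq> 0" using assms E by auto
  have "f (A + M * C) = f A" for A C
    by (rule periodic_modD[OF assms(1)]) (simp add: cong_iff_dvd_diff)
  moreover have "of_nat (card (residue_reps E)) = complex_of_real (poly_norm E)"
    using card_residue_reps[OF nz(2)] by (metis of_real_of_nat_eq)
  ultimately show ?thesis
    using periodic_mod_dvd[OF assms(1,2)] nz unfolding E
    by (simp add: sum_residue_reps_mult sum_distrib_left)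
qed

text \<open>The Chinese remainder theorem for sums. On \<open>A + M * C\<close> the function
  \<open>f\<close> sees only \<open>A\<close>; since \<open>M\<close> is invertible modulo
  \<open>E\<close>, for fixed \<open>A\<close> these elements run through all classes modulo
  \<open>E\<close> as \<open>C\<close> does.\<close>

lemma sum_residue_reps_coprime_mult:
  fixes f g :: "'a::{finite_field,field_gcd} poly \<Rightarrow> complex"
  assumes f: "periodic_mod M f" and g: "periodic_mod E g" and "coprime M E" "M \<noteq> 0" "E \<noteq> 0"
  shows "(\<Sum>A\<in>residue_reps (M * E). f A * g A) =
         (\<Sum>A\<in>residue_reps M. f A) * (\<Sum>A\<in>residue_reps E. g A)"
proof -
  have fM: "f (A + M * C) = f A" for A C
    by (rule periodic_modD[OF f]) (simp add: cong_iff_dvd_diff)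
  have gE: "(\<Sum>C\<in>residue_reps E. g (A + M * C)) = (\<Sum>C\<in>residue_reps E. g C)" for A
  proof -
    have "periodic_mod E (\<lambda>C. g (C + A))"
      by (rule periodic_modI, rule periodic_modD[OF g]) (auto intro: cong_add)
    from sum_residue_reps_scale[OF this assms(3)] sum_residue_reps_translate[OF g, of A]
    show ?thesis by (simp add: add.commute)
  qed
  have "periodic_mod (M * E) (\<lambda>A. f A * g A)"
    by (intro periodic_mod_mult periodic_mod_dvd[OF f] periodic_mod_dvd[OF g]) auto
  thus ?thesis
    by (simp add: sum_residue_reps_mult assms fM gE sum_distrib_left[symmetric] sum_distrib_right[symmetric])
qed

subsection \<open>Monic divisors, the Moebius function and the Euler function\<close>

text \<open>Nonzero constants are units and hence their own unit factors, so
  \<open>unit_factor A\<close> is the leading coefficient. This identifies the normal form behind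
  \<open>prime\<close> and \<open>gcd\<close> with being monic.\<close>

lemma normalize_poly_eq_iff_monic:
  fixes A :: "'a::{finite_field,field_gcd} poly"
  assumes "A \<noteq> 0"
  shows   "normalize A = A \<longleftrightarrow> lead_coeff A = 1"
proof -
  have uf: "unit_factor A = [:lead_coeff A:]"
    using assms by (simp add: unit_factor_poly_def monom_0 is_unit_unit_factor dvd_field_iff)
  have "lead_coeff A = 1" if "normalize A = A"
  proof -
    have "normalize (A * 1) = A" using that by simp
    hence "unit_factor A * A = A" using unit_factor_mult_normalize[of A] that by simp
    hence "unit_factor A = 1" using assms by simp
    thus ?thesis by (simp add: uf one_pCons)
  qed
  moreover have "normalize A = A" if "lead_coeff A = 1"
    using unit_factor_mult_normalize[of A] that by (simp add: uf flip: one_pCons)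
  ultimately show ?thesis by blast
qed

lemma prime_poly_iff:
  fixes P :: "'a::{finite_field,field_gcd} poly"
  shows "prime P \<longleftrightarrow> lead_coeff P = 1 \<and> irreducible P"
proof (cases "P = 0")
  case False
  thus ?thesis
    using normalize_poly_eq_iff_monic[OF False] unfolding prime_def prime_elem_iff_irreducible by blast
qed simp

lemma monic_irreducible_divisors_eq:
  fixes A :: "'a::{finite_field,field_gcd} poly"
  shows "monic_irreducible_divisors A = {P. prime P \<and> P dvd A}"
  by (auto simp: monic_irreducible_divisors_def prime_poly_iff)

lemma finite_monic_irreducible_divisors [simp]:
  fixes A :: "'a::{finite_field,field_gcd} poly"
  shows "A \<noteq> 0 \<Longrightarrow> finite (monic_irreducible_divisors A)"
  using finite_prime_divisors[of A] by (simp add: monic_irreducible_divisors_eq)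

lemma finite_monic_divisors [simp]:
  fixes H :: "'a::finite_field poly"
  assumes "H \<noteq> 0"
  shows "finite {D. lead_coeff D = 1 \<and> D dvd H}"
proof (rule finite_subset[OF _ finite_polys_below[of "Suc (degree H)"]], safe)
  fix D :: "'a poly" and i assume "D dvd H" "i \<ge> Suc (degree H)"
  hence "degree D < i" using dvd_imp_degree_le[of D H] assms by linarith
  thus "coeff D i = 0" by (rule coeff_eq_0)
qed

lemma monic_unit_eq_1:
  fixes A :: "'a::finite_field poly"
  assumes "lead_coeff A = 1" "is_unit A"
  shows "A = 1"
proof -
  obtain c where "A = [:c:]" using assms(2) by (auto simp: is_unit_poly_iff)
  with assms(1) show ?thesis by (simp add: one_pCons)
qed

lemma monic_neq_0: "lead_coeff (A :: 'a::finite_field poly) = 1 \<Longrightarrow> A \<noteq> 0"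
  by auto

lemma prod_primes_dvd:
  fixes A :: "'a::{finite_field,field_gcd} poly"
  assumes "finite X" "X \<subseteq> monic_irreducible_divisors A"
  shows "\<Prod>X dvd A"
  using assms
proof (induction X rule: finite_induct)
  case (insert P X)
  have X: "lead_coeff Q = 1 \<and> irreducible Q" if "Q \<in> X" for Q
    using insert that by (auto simp: monic_irreducible_divisors_def)
  have P: "prime P" "P dvd A" using insert by (auto simp: monic_irreducible_divisors_eq)
  have "\<not>P dvd \<Prod>X"
    using moebius_prod(1)[of X] insert X P(1) by (auto simp: monic_irreducible_divisors_eq)
  hence "coprime P (\<Prod>X)" using P(1) by (simp add: prime_imp_coprime)
  hence "P * \<Prod>X dvd A" using P insert by (intro divides_mult) auto
  thus ?case using insert by simp
qed simp

text \<open>A monic polynomial with nonzero Moebius value is squarefree, and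
  \<open>moebius_prod\<close> recognises its factors as all of its monic irreducible divisors. A
  unit gives the empty product.\<close>

lemma moebius_nonzeroE:
  fixes A :: "'a::finite_field poly"
  assumes "moebius A \<noteq> 0" "lead_coeff A = 1"
  shows "finite (monic_irreducible_divisors A)" "A = \<Prod>(monic_irreducible_divisors A)"
proof -
  have "\<exists>X. finite X \<and> (\<forall>P\<in>X. lead_coeff P = 1 \<and> irreducible P) \<and> A = \<Prod>X"
  proof (cases "is_unit A")
    case True
    hence "A = 1" using monic_unit_eq_1[OF assms(2)] by simp
    thus ?thesis by (intro exI[of _ "{}"]) auto
  next
    case False
    thus ?thesis using assms(1) unfolding moebius_def by (metis (no_types, lifting))
  qed
  then obtain X where X: "finite X" "\<And>P. P \<in> X \<Longrightarrow> lead_coeff P = 1 \<and> irreducible P" "A = \<Prod>X"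
    by blast
  from moebius_prod(1)[OF X(1,2)] X
  show "finite (monic_irreducible_divisors A)" "A = \<Prod>(monic_irreducible_divisors A)" by auto
qed

text \<open>Only squarefree divisors count, and they correspond to the sets of monic irreducible
  divisors of \<open>A\<close>. The alternating sum over these sets is the expanded product of the
  factors \<open>1 - 1\<close>, which is empty exactly for units.\<close>

lemma sum_moebius:
  fixes A :: "'a::{finite_field,field_gcd} poly"
  assumes "A \<noteq> 0"
  shows "(\<Sum>E | lead_coeff E = 1 \<and> E dvd A. moebius E) = (if is_unit A then 1 else 0)"
proof -
  let ?I = "monic_irreducible_divisors A"
  have I: "lead_coeff P = 1 \<and> irreducible P" if "P \<in> X" "X \<subseteq> ?I" for X P
    using that by (auto simp: monic_irreducible_divisors_def)
  have fin: "finite ?I" using assms by simp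
  have fX: "finite X" if "X \<subseteq> ?I" for X using that fin finite_subset by blast
  have inj: "inj_on \<Prod> (Pow ?I)"
  proof (rule inj_onI)
    fix X Y assume XY: "X \<in> Pow ?I" "Y \<in> Pow ?I" "\<Prod>X = \<Prod>Y"
    have "X = monic_irreducible_divisors (\<Prod>X)"
      by (rule moebius_prod(1)[symmetric]) (use XY I[of _ X] fX in auto)
    also have "\<dots> = monic_irreducible_divisors (\<Prod>Y)" using XY by simp
    also have "\<dots> = Y"
      by (rule moebius_prod(1)) (use XY I[of _ Y] fX in auto)
    finally show "X = Y" .
  qed
  have "(\<Sum>E | lead_coeff E = 1 \<and> E dvd A. moebius E) = (\<Sum>E\<in>\<Prod> ` Pow ?I. moebius E)"
  proof (rule sum.mono_neutral_right)
    show "\<Prod> ` Pow ?I \<subseteq> {E. lead_coeff E = 1 \<and> E dvd A}"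
      using I fX by (auto simp: lead_coeff_prod intro!: prod_primes_dvd prod.neutral)
    show "\<forall>E\<in>{E. lead_coeff E = 1 \<and> E dvd A} - \<Prod> ` Pow ?I. moebius E = 0"
    proof safe
      fix E assume E: "lead_coeff E = 1" "E dvd A" "E \<notin> \<Prod> ` Pow ?I"
      have "monic_irreducible_divisors E \<in> Pow ?I"
        using E dvd_trans by (auto simp: monic_irreducible_divisors_def)
      thus "moebius E = 0" using moebius_nonzeroE(2)[of E] E by blast
    qed
  qed (use assms in auto)
  also have "\<dots> = (\<Sum>X\<in>Pow ?I. moebius (\<Prod>X))"
    by (subst sum.reindex[OF inj]) simp
  also have "\<dots> = (\<Sum>X\<in>Pow ?I. (-1) ^ card X)"
    by (intro sum.cong refl moebius_prod(2)) (use I fX in auto)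
  also have "\<dots> = (\<Prod>P\<in>?I. 1 - 1)"
    by (subst prod_diff_conv_sum) (auto simp: fin)
  also have "\<dots> = (if ?I = {} then 1 else 0)"
    using fin by (auto simp: card_gt_0_iff)
  also have "?I = {} \<longleftrightarrow> is_unit A"
    using prime_divisor_exists[OF assms] dvd_trans not_prime_unit
    by (auto simp: monic_irreducible_divisors_eq)
  finally show ?thesis .
qed

text \<open>Moebius inversion: after interchanging the sums, the coefficient of \<open>F C\<close>
  is the sum of \<open>moebius\<close> over the divisors of \<open>G div C\<close>, which vanishes
  unless \<open>C = G\<close>.\<close>

lemma sum_dirichlet_conv_moebius:
  fixes G :: "'a::{finite_field,field_gcd} poly"
  assumes "lead_coeff G = 1"
  shows "(\<Sum>M | lead_coeff M = 1 \<and> M dvd G. dirichlet_conv moebius F M) = F G"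
proof -
  let ?Dv = "\<lambda>A::'a poly. {D. lead_coeff D = 1 \<and> D dvd A}"
  have G0: "G \<noteq> 0" using assms by auto
  have fin: "finite (?Dv A)" if "A dvd G" for A
    using that G0 by (intro finite_monic_divisors) auto
  have "(\<Sum>M\<in>?Dv G. dirichlet_conv moebius F M) = (\<Sum>(M, E)\<in>Sigma (?Dv G) ?Dv. moebius E * F (M div E))"
    unfolding dirichlet_conv_def using fin by (subst sum.Sigma) auto
  \<comment> \<open>A divisor \<open>E\<close> of \<open>M\<close> is paired with its cofactor
    \<open>C = M div E\<close> instead of with \<open>M\<close>.\<close>
  also have "\<dots> = (\<Sum>(C, E)\<in>Sigma (?Dv G) (\<lambda>C. ?Dv (G div C)). F C * moebius E)"
  proof (rule sum.reindex_bij_witness[where i = "\<lambda>(C, E). (C * E, E)" and j = "\<lambda>(M, E). (M div E, E)"], goal_cases)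
    case (2 a)
    thus ?case by (auto elim!: dvdE simp: lead_coeff_mult)
  next
    case (4 a)
    thus ?case using G0 by (auto elim!: dvdE simp: lead_coeff_mult) 
  qed (auto elim!: dvdE simp: lead_coeff_mult)
  also have "\<dots> = (\<Sum>C\<in>?Dv G. F C * (\<Sum>E\<in>?Dv (G div C). moebius E))"
    using fin by (subst sum.Sigma [symmetric]) (auto simp: sum_distrib_left div_dvd_iff_mult)
  also have "\<dots> = (\<Sum>C\<in>?Dv G. if C = G then F C else 0)"
  proof (intro sum.cong refl)
    fix C assume C: "C \<in> ?Dv G"
    then obtain B where B: "G = C * B" by (auto elim: dvdE)
    have "C \<noteq> 0" "B \<noteq> 0" using G0 B by auto
    moreover have "is_unit B \<longleftrightarrow> C = G"
    proof
      assume "is_unit B"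
      moreover have "lead_coeff B = 1" using C B assms by (simp add: lead_coeff_mult)
      ultimately show "C = G" using monic_unit_eq_1 B by auto
    next
      assume "C = G" thus "is_unit B" using B G0 by auto
    qed
    ultimately show "F C * (\<Sum>E\<in>?Dv (G div C). moebius E) = (if C = G then F C else 0)"
      using sum_moebius[of B] by (simp add: B)
  qed
  also have "\<dots> = F G" using fin[of G] assms by simp
  finally show ?thesis .
qed

section \<open>The indicator function of the units and the Euler function\<close>

definition coprime_indicator :: "'a::finite_field poly \<Rightarrow> 'a poly \<Rightarrow> complex" where
  "coprime_indicator H A = (if coprime A H then 1 else 0)"

lemma cong_coprime_iff:
  fixes A B H :: "'a::{finite_field,field_gcd} poly"
  shows "[A = B] (mod H) \<Longrightarrow> coprime A H \<longleftrightarrow> coprime B H"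
  by (metis cong_imp_coprime cong_sym)

lemma periodic_coprime_indicator:
  fixes H :: "'a::{finite_field,field_gcd} poly"
  shows "periodic_mod H (coprime_indicator H)"
  by (rule periodic_modI) (simp add: coprime_indicator_def cong_coprime_iff)

lemma coprime_indicator_mult:
  fixes M E :: "'a::{finite_field,field_gcd} poly"
  shows "coprime_indicator (M * E) A = coprime_indicator M A * coprime_indicator E A"
  by (auto simp: coprime_indicator_def)

text \<open>This is \<open>sum_moebius\<close> at \<open>gcd A H\<close>, which is a unit exactly
  when \<open>A\<close> and \<open>H\<close> are coprime.\<close>

lemma coprime_indicator_eq_sum_moebius:
  fixes H :: "'a::{finite_field,field_gcd} poly"
  assumes "H \<noteq> 0"
  shows "coprime_indicator H A = (\<Sum>E | lead_coeff E = 1 \<and> E dvd H. if E dvd A then moebius E else 0)"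
proof -
  have "coprime_indicator H A = (\<Sum>E | lead_coeff E = 1 \<and> E dvd gcd A H. moebius E)"
    using assms by (subst sum_moebius) (auto simp: coprime_indicator_def is_unit_gcd)
  also have "\<dots> = (\<Sum>E | lead_coeff E = 1 \<and> E dvd H. if E dvd A then moebius E else 0)"
    using assms by (subst sum.If_cases) (auto intro!: sum.cong)
  finally show ?thesis .
qed

lemma CARD_finite_field_gt_1: "1 < CARD('a::finite_field)"
proof -
  have "card {0, 1::'a} \<le> CARD('a)" by (intro card_mono) auto
  thus ?thesis by simp
qed

lemma poly_norm_pos: "poly_norm A > 0"
  by (simp add: poly_norm_def)

lemma poly_norm_mult:
  "A \<noteq> 0 \<Longrightarrow> B \<noteq> 0 \<Longrightarrow> poly_norm (A * B) = poly_norm A * poly_norm B"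
  by (simp add: poly_norm_def degree_mult_eq power_add)

lemma poly_norm_power: "A \<noteq> 0 \<Longrightarrow> poly_norm (A ^ n) = poly_norm A ^ n"
  by (simp add: poly_norm_def degree_power_eq mult.commute flip: power_mult)

lemma euler_phi_pos:
  fixes H :: "'a::finite_field poly"
  shows "euler_phi H > 0"
  unfolding euler_phi_def
proof (intro mult_pos_pos prod_pos poly_norm_pos)
  fix P :: "'a poly" assume "P \<in> monic_irreducible_divisors H"
  hence "irreducible P" by (simp add: monic_irreducible_divisors_def)
  hence "degree P > 0"
    by (metis bot_nat_0.not_eq_extremum irreducible_def is_unit_iff_degree)
  hence "poly_norm P > 1"
    using CARD_finite_field_gt_1[where ?'a = 'a] by (simp add: poly_norm_def)
  thus "0 < 1 - 1 / poly_norm P" by simp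
qed

lemma residue_reps_unit: "is_unit H \<Longrightarrow> residue_reps H = {0}"
  by (auto simp: residue_reps_def unit_imp_mod_eq_0)

text \<open>The product formula for \<open>euler_phi\<close> counts units. Along the prime
  factorisation, a repeated prime \<open>P\<close> leaves the coprimality condition unchanged and
  multiplies the count by \<open>poly_norm P\<close>; a new prime contributes
  \<open>poly_norm P - 1\<close> by the Chinese remainder theorem.\<close>

lemma sum_coprime_indicator:
  fixes H :: "'a::{finite_field,field_gcd} poly"
  assumes "H \<noteq> 0"
  shows "(\<Sum>A\<in>residue_reps H. coprime_indicator H A) = of_real (euler_phi H)"
  using assms
proof (induction H rule: prime_divisors_induct)
  case (unit H)
  have "monic_irreducible_divisors H = {}"
    using unit dvd_trans not_prime_unit by (auto simp: monic_irreducible_divisors_eq)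
  moreover have "degree H = 0" using unit is_unit_iff_degree by auto
  ultimately show ?case using unit
    by (simp add: residue_reps_unit coprime_indicator_def euler_phi_def poly_norm_def)
next
  case (factor P X)
  have P0: "P \<noteq> 0" and X0: "X \<noteq> 0" using factor by auto
  have midPX: "monic_irreducible_divisors (P * X) = insert P (monic_irreducible_divisors X)"
    using factor by (auto simp: monic_irreducible_divisors_eq prime_dvd_mult_iff primes_dvd_imp_eq)
  show ?case
  proof (cases "P dvd X")
    case True
    have "coprime_indicator (P * X) = coprime_indicator X"
      using True by (auto simp: coprime_indicator_def fun_eq_iff intro: coprime_divisors[OF dvd_refl])
    moreover have "insert P (monic_irreducible_divisors X) = monic_irreducible_divisors X"
      using True factor by (auto simp: monic_irreducible_divisors_eq)
    ultimately show ?thesis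
      using factor.IH[OF X0] P0 X0
      by (simp add: sum_residue_reps_periodic_dvd[OF periodic_coprime_indicator, of X "P * X"]
            euler_phi_def midPX poly_norm_mult)
  next
    case False
    have "(\<Sum>A\<in>residue_reps (P * X). coprime_indicator (P * X) A) =
          (\<Sum>A\<in>residue_reps P. coprime_indicator P A) * (\<Sum>A\<in>residue_reps X. coprime_indicator X A)"
      unfolding coprime_indicator_mult using False factor P0 X0
      by (intro sum_residue_reps_coprime_mult periodic_coprime_indicator) (auto simp: prime_imp_coprime)
    moreover have "(\<Sum>A\<in>residue_reps P. coprime_indicator P A) = of_real (poly_norm P - 1)"
    proof -
      have "coprime_indicator P A = 1 - (if A = 0 then 1 else 0)" if "A \<in> residue_reps P" for A
      proof -
        have "coprime A P \<longleftrightarrow> A \<noteq> 0"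
        proof (cases "A = 0")
          case False
          hence "\<not>P dvd A" using that P0 by (auto simp: residue_reps_altdef dest: dvd_imp_degree_le)
          thus ?thesis using False factor(1) prime_imp_coprime[of P A] by (simp add: coprime_commute)
        qed (use factor in auto)
        thus ?thesis by (simp add: coprime_indicator_def)
      qed
      hence "(\<Sum>A\<in>residue_reps P. coprime_indicator P A) =
             (\<Sum>A\<in>residue_reps P. 1 - (if A = 0 then 1 else 0))"
        by (rule sum.cong[OF refl])
      also have "\<dots> = of_nat (card (residue_reps P)) - 1"
      proof -
        have "0 \<in> residue_reps P" by (simp add: residue_reps_def)
        thus ?thesis using P0 by (simp add: sum_subtractf)
      qed
      finally show ?thesis
        using card_residue_reps[OF P0] by (metis of_real_1 of_real_diff of_real_of_nat_eq)
    qed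
    moreover have "P \<notin> monic_irreducible_divisors X"
      using False by (simp add: monic_irreducible_divisors_def)
    hence "euler_phi (P * X) = (poly_norm P - 1) * euler_phi X"
      using P0 X0 poly_norm_pos[of P]
      by (simp add: euler_phi_def midPX poly_norm_mult field_simps)
    ultimately show ?thesis using factor.IH[OF X0] by simp
  qed
qed auto

lemma euler_phi_coprime_mult:
  fixes M E :: "'a::{finite_field,field_gcd} poly"
  assumes "coprime M E" "M \<noteq> 0" "E \<noteq> 0"
  shows "euler_phi (M * E) = euler_phi M * euler_phi E"
proof -
  have "complex_of_real (euler_phi (M * E)) = of_real (euler_phi M * euler_phi E)"
    using assms sum_residue_reps_coprime_mult[OF periodic_coprime_indicator periodic_coprime_indicator, of M E]
    by (simp add: sum_coprime_indicator flip: coprime_indicator_mult)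
  thus ?thesis by (simp only: of_real_eq_iff)
qed

subsection \<open>Additive characters\<close>

text \<open>Exactly one class modulo \<open>M\<close> satisfies the condition, and it splits into
  \<open>poly_norm (H div M)\<close> classes modulo \<open>H\<close>.\<close>

lemma sum_dvd_diff_indicator:
  fixes H M :: "'a::finite_field poly"
  assumes "M dvd H" "H \<noteq> 0"
  shows "(\<Sum>C\<in>residue_reps H. if M dvd A - C then 1 else 0) = complex_of_real (poly_norm (H div M))"
proof -
  have M0: "M \<noteq> 0" using assms by auto
  have iff: "M dvd A - C \<longleftrightarrow> [C = A] (mod M)" for C
    by (metis cong_iff_dvd_diff cong_sym_eq)
  have "periodic_mod M (\<lambda>C. if M dvd A - C then 1 else 0 :: complex)"
    unfolding iff by (rule periodic_modI) (metis cong_sym cong_trans)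
  note sum_residue_reps_periodic_dvd[OF this assms]
  moreover have "(\<Sum>C\<in>residue_reps M. if M dvd A - C then 1 else 0 :: complex) =
                 (\<Sum>C\<in>residue_reps M. if C = A mod M then 1 else 0)"
    by (intro sum.cong refl) (auto simp: iff cong_def residue_reps_def)
  ultimately show ?thesis using M0 by simp
qed

text \<open>The standard additive character of the coefficient field. Isolating it from
  \<open>additive_character\<close> reduces additivity and nontriviality to statements about single
  coefficients.\<close>

definition field_character :: "'a::finite_field \<Rightarrow> complex" where
  "field_character x = exp (2 * of_real pi * \<i> / of_nat CHAR('a) *
     of_nat (prime_field_rep (field_trace x)))"

lemma prime_field_rep_trace:
  fixes x :: "'a::finite_field"
  shows "prime_field_rep (field_trace x) < CHAR('a)"
    and "of_nat (prime_field_rep (field_trace x)) = field_trace x"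
  using theI'[OF prime_field_rep_field_trace[of x]] by (simp_all add: prime_field_rep_def)

lemma field_trace_add:
  fixes x y :: "'a::finite_field"
  shows "field_trace (x + y) = field_trace x + field_trace y"
  unfolding field_trace_def
  by (subst sum.distrib [symmetric], intro sum.cong refl freshmans_dream') auto

text \<open>The trace is given by a polynomial of degree at most \<open>p^(n-1)\<close>, less than
  the size \<open>p^n\<close> of the field. Its linear coefficient is 1, so it is not the zero
  polynomial and cannot vanish everywhere.\<close>

lemma field_trace_nonzero: "\<exists>x :: 'a::finite_field. field_trace x \<noteq> 0"
proof -
  let ?p = "CHAR('a)"
  have p1: "?p > 1" using prime_gt_1_nat[of ?p] by simp
  define n where "n = (THE n. CARD('a) = ?p ^ n)"
  have n: "CARD('a) = ?p ^ n" unfolding n_def by (rule theI'[OF card_finite_field])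
  have n0: "n > 0" using n CARD_finite_field_gt_1[where ?'a = 'a] by (cases n) auto
  define f where "f = (\<Sum>j<n. monom (1::'a) (?p ^ j))"
  have ev: "poly f x = field_trace x" for x
    by (simp add: f_def field_trace_def n_def poly_sum poly_monom)
  have "coeff f 1 = (\<Sum>j<n. if j = 0 then 1 else 0)"
    unfolding f_def coeff_sum using p1 by (intro sum.cong) auto
  hence f0: "f \<noteq> 0" using n0 by auto
  have "degree f \<le> ?p ^ (n - 1)" unfolding f_def
  proof (rule degree_sum_le)
    fix j assume "j \<in> {..<n}"
    hence "?p ^ j \<le> ?p ^ (n - 1)" using p1 by (intro power_increasing) auto
    thus "degree (monom (1::'a) (?p ^ j)) \<le> ?p ^ (n - 1)" by (simp add: degree_monom_eq)
  qed auto
  also have "\<dots> < CARD('a)" unfolding n using p1 n0 by (intro power_strict_increasing) auto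
  finally have "card {x. poly f x = 0} < CARD('a)"
    using card_poly_roots_bound[OF f0] by linarith
  hence "{x. poly f x = 0} \<noteq> UNIV" by auto
  thus ?thesis by (auto simp: ev)
qed

text \<open>Powers of a \<open>p\<close>-th root of unity depend only on the exponent modulo
  \<open>p\<close>. For \<open>p = 0\<close> the quotient is 0 by convention and both sides are
  1.\<close>

lemma exp_root_cong:
  assumes "[j = k] (mod p)"
  shows "exp (2 * of_real pi * \<i> / of_nat p * of_nat j) = exp (2 * of_real pi * \<i> / of_nat p * of_nat k :: complex)"
proof (cases "p = 0")
  case False
  let ?w = "exp (2 * of_real pi * \<i> / of_nat p) :: complex"
  have e: "exp (2 * of_real pi * \<i> / of_nat p * of_nat j) = ?w ^ j" for j
    by (simp add: mult.commute flip: exp_of_nat_mult)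
  have "?w ^ p = 1" using False by (simp flip: exp_of_nat_mult)
  hence "?w ^ (p * (j div p) + j mod p) = ?w ^ (j mod p)" for j
    unfolding power_add power_mult by simp
  hence "?w ^ j = ?w ^ (j mod p)" for j by simp
  with assms show ?thesis unfolding e cong_def by metis
qed simp

lemma field_character_0 [simp]: "field_character (0 :: 'a::finite_field) = 1"
proof -
  have "field_trace (0::'a) = 0" using field_trace_add[of 0 "0::'a"]
    by (metis add.right_neutral add_left_cancel)
  hence "of_nat (prime_field_rep (field_trace (0::'a))) = (of_nat 0 :: 'a)"
    using prime_field_rep_trace(2)[of "0::'a"] by simp
  hence "prime_field_rep (field_trace (0::'a)) = 0"
    using prime_field_rep_trace(1)[of "0::'a"] by (intro of_nat_inj_CHAR[where ?'a = 'a]) auto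
  thus ?thesis by (simp add: field_character_def)
qed

text \<open>The representatives of the traces add up only modulo the characteristic, which is the
  period of the exponential.\<close>

lemma field_character_add:
  fixes x y :: "'a::finite_field"
  shows "field_character (x + y) = field_character x * field_character y"
proof -
  let ?k = "\<lambda>x::'a. prime_field_rep (field_trace x)"
  have "of_nat (?k (x + y)) = (of_nat (?k x + ?k y) :: 'a)"
    by (simp only: of_nat_add prime_field_rep_trace(2)) (rule field_trace_add)
  hence "[?k (x + y) = ?k x + ?k y] (mod CHAR('a))"
    by (simp only: of_nat_eq_iff_cong_CHAR)
  from exp_root_cong[OF this] show ?thesis
    by (simp add: field_character_def ring_distribs exp_add)
qed

text \<open>A nonzero trace has a representative \<open>k\<close> with \<open>0 < k < p\<close>. If
  the cosine of the angle were 1, then \<open>p\<close> would divide \<open>k\<close>.\<close>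

lemma field_character_nontrivial: "\<exists>x :: 'a::finite_field. field_character x \<noteq> 1"
proof -
  obtain x :: 'a where x: "field_trace x \<noteq> 0" using field_trace_nonzero by blast
  define k where "k = prime_field_rep (field_trace x)"
  let ?p = "CHAR('a)"
  have k: "k < ?p" "of_nat k = field_trace x" unfolding k_def by (rule prime_field_rep_trace)+
  have k0: "k > 0" using k(2) x by (cases k) auto
  have "field_character x = cis (2 * pi * real k / real ?p)"
    unfolding field_character_def k_def[symmetric] cis_conv_exp by (simp add: mult_ac)
  moreover have "cos (2 * pi * real k / real ?p) \<noteq> 1"
  proof
    assume "cos (2 * pi * real k / real ?p) = 1"
    then obtain i :: int where "2 * pi * real k / real ?p = of_int i * 2 * pi"
      by (auto simp: cos_one_2pi_int)
    hence eq: "real k = of_int i * real ?p" using k by (simp add: field_simps)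
    hence "int k = i * int ?p" by (metis of_int_eq_iff of_int_mult of_int_of_nat_eq)
    hence "?p dvd k" by (metis dvd_triv_right int_dvd_int_iff)
    thus False using k k0 by (auto dest: dvd_imp_le)
  qed
  ultimately have "field_character x \<noteq> 1" by (auto simp: complex_eq_iff)
  thus ?thesis ..
qed

lemma additive_character_altdef:
  "additive_character G H B = field_character (top_residue_coeff H (G * B))"
  by (simp add: additive_character_def field_character_def)

lemma additive_character_add:
  fixes G H :: "'a::finite_field poly"
  shows "additive_character G H (B + C) = additive_character G H B * additive_character G H C"
  by (simp add: additive_character_altdef top_residue_coeff_def ring_distribs poly_mod_add_left
        flip: field_character_add)

lemma periodic_additive_character:
  fixes G H :: "'a::finite_field poly"
  shows "periodic_mod H (additive_character G H)"
proof (rule periodic_modI)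
  fix A B assume "[A = B] (mod H)"
  hence "[G * A = G * B] (mod H)" by (rule cong_scalar_left)
  thus "additive_character G H A = additive_character G H B"
    by (simp add: additive_character_altdef top_residue_coeff_def cong_def)
qed

text \<open>Orthogonality on the subgroup of multiples of \<open>M\<close>: if
  \<open>H div M\<close> divides \<open>W\<close>, every term is 1; otherwise the character is
  nontrivial there, and translation by a suitable multiple of \<open>M\<close> forces the sum to
  vanish.\<close>

lemma sum_additive_character_multiples:
  fixes H M W :: "'a::finite_field poly"
  assumes "M dvd H" "H \<noteq> 0"
  shows "(\<Sum>B\<in>residue_reps H. if M dvd B then additive_character W H B else 0) =
         (if H div M dvd W then of_real (poly_norm (H div M)) else 0)"
proof -
  obtain E where E: "H = M * E" using assms(1) by (elim dvdE)
  have nz: "M \<noteq> 0" "E \<noteq> 0" using assms E by auto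
  show ?thesis
  proof (cases "E dvd W")
    case True
    have "additive_character W H B = 1" if "M dvd B" for B
    proof -
      have "H dvd W * B" using mult_dvd_mono[OF True that] by (simp add: E mult.commute)
      thus ?thesis by (simp add: additive_character_altdef top_residue_coeff_def)
    qed
    hence "(\<Sum>B\<in>residue_reps H. if M dvd B then additive_character W H B else 0) =
           (\<Sum>B\<in>residue_reps H. if M dvd 0 - B then 1 else 0)"
      by (intro sum.cong) auto
    also have "\<dots> = of_real (poly_norm (H div M))"
      using assms by (rule sum_dvd_diff_indicator)
    finally show ?thesis using True nz E by simp
  next
    case False
    let ?f = "\<lambda>B. if M dvd B then additive_character W H B else 0"
    define R where "R = (W * M) mod H"
    have R0: "R \<noteq> 0"
      using False nz unfolding R_def E by (auto simp: mod_eq_0_iff_dvd mult.commute)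
    have dR: "degree R < degree H"
      using degree_mod_less'[of H "W * M"] R0 assms by (simp add: R_def)
    obtain z :: 'a where z: "field_character z \<noteq> 1" using field_character_nontrivial by blast
    hence z0: "z \<noteq> 0" by auto
    \<comment> \<open>Degree and leading coefficient of \<open>C\<close> are chosen so that
      \<open>R * C\<close> has degree \<open>degree H - 1\<close> and leading coefficient
      \<open>z\<close>. It is then already reduced, and its top residue coefficient is
      \<open>z\<close>.\<close>
    define C where "C = monom (z / lead_coeff R) (degree H - 1 - degree R)"
    have C0: "C \<noteq> 0" using z0 R0 by (simp add: C_def)
    have dRC: "degree (R * C) = degree H - 1"
      using R0 C0 dR z0 by (simp add: degree_mult_eq) (simp add: C_def degree_monom_eq)
    have "(W * (M * C)) mod H = (R * C) mod H"
      by (simp add: R_def mod_mult_left_eq mult.assoc)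
    also have "\<dots> = R * C" using dRC dR by (intro mod_poly_less) auto
    finally have "top_residue_coeff H (W * (M * C)) = lead_coeff (R * C)"
      by (simp add: top_residue_coeff_def dRC)
    also have "lead_coeff C = z / lead_coeff R" unfolding C_def by (rule lead_coeff_monom)
    hence "lead_coeff (R * C) = z" using R0 by (simp add: lead_coeff_mult)
    finally have ne: "additive_character W H (M * C) \<noteq> 1"
      using z by (simp add: additive_character_altdef)
    have "periodic_mod H ?f"
    proof (rule periodic_modI)
      fix A B assume AB: "[A = B] (mod H)"
      hence "M dvd A \<longleftrightarrow> M dvd B" using assms(1) cong_dvd_iff cong_dvd_modulus by blast
      thus "?f A = ?f B" using periodic_modD[OF periodic_additive_character AB] by simp
    qed
    from sum_residue_reps_translate[OF this, of "M * C"]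
    have "(\<Sum>B\<in>residue_reps H. ?f B) = (\<Sum>B\<in>residue_reps H. ?f (B + M * C))" ..
    also have "\<dots> = additive_character W H (M * C) * (\<Sum>B\<in>residue_reps H. ?f B)"
      unfolding sum_distrib_left
      by (intro sum.cong refl) (auto simp: additive_character_add dvd_add_left_iff)
    finally have "(\<Sum>B\<in>residue_reps H. ?f B) = 0" using ne by simp
    thus ?thesis using False E nz by simp
  qed
qed

subsection \<open>Sums over tuples of units\<close>

text \<open>
  This is the sum of \<open>f K\<^sub>0\<close> over all tuples \<open>(K\<^sub>0, \<dots>, K\<^sub>n)\<close> of residue classes with sum \<open>A\<close> such that
  \<open>K\<^sub>1, \<dots>, K\<^sub>n\<close> are units, so \<open>n\<close> is one less than the length of the tuple.
\<close>
primrec unit_conv :: "'a::finite_field poly \<Rightarrow> ('a poly \<Rightarrow> complex) \<Rightarrow> nat \<Rightarrow> 'a poly \<Rightarrow> complex" where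
  "unit_conv H f 0 A = f A"
| "unit_conv H f (Suc n) A = (\<Sum>K\<in>residue_reps H. coprime_indicator H K * unit_conv H f n (A - K))"

lemma periodic_unit_conv:
  assumes "periodic_mod H f"
  shows "periodic_mod H (unit_conv H f n)"
proof (induction n)
  case (Suc n)
  show ?case
  proof (rule periodic_modI)
    fix A B assume AB: "[A = B] (mod H)"
    have "unit_conv H f n (A - K) = unit_conv H f n (B - K)" for K
      using AB by (intro periodic_modD[OF Suc]) (auto intro: cong_diff)
    thus "unit_conv H f (Suc n) A = unit_conv H f (Suc n) B" by simp
  qed
qed (use assms in simp)

lemma sum_PiE_insert:
  fixes g :: "('b \<Rightarrow> 'c) \<Rightarrow> complex"
  assumes "x \<notin> S"
  shows "(\<Sum>K\<in>Pi\<^sub>E (insert x S) T. g K) = (\<Sum>y\<in>T x. \<Sum>K\<in>Pi\<^sub>E S T. g (K(x := y)))"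
  unfolding PiE_insert_eq
  by (subst sum.reindex[OF inj_combinator[OF assms]]) (simp add: sum.cartesian_product case_prod_unfold)

text \<open>The tuples are grouped by their sum. The induction splits off the last entry
  \<open>k\<close> and replaces the weight \<open>w\<close> by its translate by \<open>k\<close>,
  hence the generalisation over \<open>w\<close>.\<close>

lemma sum_tuples_unit_conv:
  fixes H :: "'a::{finite_field,field_gcd} poly"
  assumes f: "periodic_mod H f" and w: "periodic_mod H w"
  shows "(\<Sum>K\<in>{1..Suc n} \<rightarrow>\<^sub>E residue_reps H.
            f (K 1) * (\<Prod>i=2..Suc n. coprime_indicator H (K i)) * w (\<Sum>i=1..Suc n. K i)) =
         (\<Sum>A\<in>residue_reps H. w A * unit_conv H f n A)"
  using w
proof (induction n arbitrary: w)
  case 0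
  have "{1..Suc 0} = insert 1 {}" by auto
  thus ?case by (simp add: sum_PiE_insert mult.commute)
next
  case (Suc n)
  let ?R = "residue_reps H" and ?N = "Suc (Suc n)"
  have ins: "{1..?N} = insert ?N {1..Suc n}" "{2..?N} = insert ?N {2..Suc n}" by auto
  have "(\<Sum>K\<in>{1..?N} \<rightarrow>\<^sub>E ?R.
            f (K 1) * (\<Prod>i=2..?N. coprime_indicator H (K i)) * w (\<Sum>i=1..?N. K i)) =
        (\<Sum>k\<in>?R. \<Sum>K\<in>{1..Suc n} \<rightarrow>\<^sub>E ?R.
            f (K 1) * (coprime_indicator H k * (\<Prod>i=2..Suc n. coprime_indicator H (K i))) *
            w (k + (\<Sum>i=1..Suc n. K i)))"
    unfolding ins by (subst sum_PiE_insert) (auto intro!: sum.cong prod.cong arg_cong[of _ _ w])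
  also have "\<dots> = (\<Sum>k\<in>?R. coprime_indicator H k * (\<Sum>K\<in>{1..Suc n} \<rightarrow>\<^sub>E ?R.
            f (K 1) * (\<Prod>i=2..Suc n. coprime_indicator H (K i)) * w ((\<Sum>i=1..Suc n. K i) + k)))"
    by (simp add: sum_distrib_left mult_ac add.commute)
  also have "\<dots> = (\<Sum>k\<in>?R. coprime_indicator H k * (\<Sum>A\<in>?R. w (A + k) * unit_conv H f n A))"
  proof (rule sum.cong[OF refl], rule arg_cong2[of _ _ _ _ "(*)", OF refl])
    fix k
    have "periodic_mod H (\<lambda>A. w (A + k))"
      by (rule periodic_modI, rule periodic_modD[OF Suc.prems]) (auto intro: cong_add)
    from Suc.IH[OF this]
    show "(\<Sum>K\<in>{1..Suc n} \<rightarrow>\<^sub>E ?R. f (K 1) * (\<Prod>i=2..Suc n. coprime_indicator H (K i)) *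
            w ((\<Sum>i=1..Suc n. K i) + k)) = (\<Sum>A\<in>?R. w (A + k) * unit_conv H f n A)" .
  qed
  \<comment> \<open>Substituting \<open>A - k\<close> for \<open>A\<close> moves the shift from
    \<open>w\<close> to \<open>unit_conv\<close>, where it matches the recursion.\<close>
  also have "\<dots> = (\<Sum>k\<in>?R. coprime_indicator H k * (\<Sum>A\<in>?R. w A * unit_conv H f n (A - k)))"
  proof (rule sum.cong[OF refl], rule arg_cong2[of _ _ _ _ "(*)", OF refl])
    fix k
    have "periodic_mod H (\<lambda>A. w A * unit_conv H f n (A - k))"
      by (intro periodic_mod_mult Suc.prems periodic_mod_translate periodic_unit_conv f)
    from sum_residue_reps_translate[OF this, of k]
    show "(\<Sum>A\<in>?R. w (A + k) * unit_conv H f n A) = (\<Sum>A\<in>?R. w A * unit_conv H f n (A - k))"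
      by simp
  qed
  also have "\<dots> = (\<Sum>A\<in>?R. w A * unit_conv H f (Suc n) A)"
    unfolding unit_conv.simps sum_distrib_left
    by (subst sum.swap, intro sum.cong refl) (simp only: mult_ac)
  finally show ?case .
qed

lemma coprime_prod_left_iff:
  fixes H :: "'a::{finite_field,field_gcd} poly"
  assumes "finite I"
  shows "coprime (\<Prod>i\<in>I. K i) H \<longleftrightarrow> (\<forall>i\<in>I. coprime (K i) H)"
  using assms by (induction I rule: finite_induct) auto

lemma prod_coprime_indicator:
  fixes H :: "'a::{finite_field,field_gcd} poly"
  assumes "finite I"
  shows "(\<Prod>i\<in>I. coprime_indicator H (K i)) = (if coprime (\<Prod>i\<in>I. K i) H then 1 else 0)"
  using assms by (induction I rule: finite_induct) (auto simp: coprime_indicator_def)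

text \<open>Coprimality of the product is a condition on each entry: \<open>f\<close> enforces it
  for the first one by vanishing off the units, indicator functions for the others. The condition on
  the sum goes into the weight.\<close>

lemma sum_unit_tuples:
  fixes H :: "'a::{finite_field,field_gcd} poly"
  assumes H0: "H \<noteq> 0" and l: "l \<ge> 1"
    and f: "periodic_mod H f" "\<And>A. \<not>coprime A H \<Longrightarrow> f A = 0" and g: "periodic_mod H g"
  shows "(\<Sum>K \<in> {K \<in> {1..l} \<rightarrow>\<^sub>E residue_reps H.
                coprime (\<Sum>i=1..l. K i) H \<and> coprime (\<Prod>i=1..l. K i) H}. f (K 1) * g (\<Sum>i=1..l. K i)) =
         (\<Sum>A\<in>residue_reps H. coprime_indicator H A * g A * unit_conv H f (l - 1) A)"
proof -
  obtain n where n: "l = Suc n" using l by (cases l) auto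
  have fin: "finite ({1..l} \<rightarrow>\<^sub>E residue_reps H)" using H0 by (intro finite_PiE) auto
  have ins: "{1..l} = insert 1 {2..l}" using l by auto
  have "(\<Sum>K \<in> {K \<in> {1..l} \<rightarrow>\<^sub>E residue_reps H.
                coprime (\<Sum>i=1..l. K i) H \<and> coprime (\<Prod>i=1..l. K i) H}. f (K 1) * g (\<Sum>i=1..l. K i)) =
        (\<Sum>K \<in> {1..l} \<rightarrow>\<^sub>E residue_reps H. if coprime (\<Sum>i=1..l. K i) H \<and> coprime (\<Prod>i=1..l. K i) H
           then f (K 1) * g (\<Sum>i=1..l. K i) else 0)"
    using fin by (rule sum.inter_filter)
  also have "\<dots> = (\<Sum>K \<in> {1..l} \<rightarrow>\<^sub>E residue_reps H. f (K 1) * (\<Prod>i=2..l. coprime_indicator H (K i)) *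
              (coprime_indicator H (\<Sum>i=1..l. K i) * g (\<Sum>i=1..l. K i)))"
  proof (intro sum.cong refl)
    fix K :: "nat \<Rightarrow> 'a poly"
    have "(\<Prod>i=1..l. K i) = K 1 * (\<Prod>i=2..l. K i)" unfolding ins by simp
    moreover have pc: "(\<Prod>i=2..l. coprime_indicator H (K i)) =
        (if coprime (\<Prod>i=2..l. K i) H then 1 else 0)" by (rule prod_coprime_indicator) simp
    ultimately show "(if coprime (\<Sum>i=1..l. K i) H \<and> coprime (\<Prod>i=1..l. K i) H
           then f (K 1) * g (\<Sum>i=1..l. K i) else 0) =
          f (K 1) * (\<Prod>i=2..l. coprime_indicator H (K i)) *
              (coprime_indicator H (\<Sum>i=1..l. K i) * g (\<Sum>i=1..l. K i))"
      unfolding pc using f(2)[of "K 1"] by (auto simp: coprime_indicator_def)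
  qed
  also have "\<dots> = (\<Sum>A\<in>residue_reps H. coprime_indicator H A * g A * unit_conv H f (l - 1) A)"
    using sum_tuples_unit_conv[OF f(1) periodic_mod_mult[OF periodic_coprime_indicator g], of n]
    by (simp add: n)
  finally show ?thesis .
qed

lemma coprime_indicator_unit_mult:
  fixes H :: "'a::{finite_field,field_gcd} poly"
  shows "coprime U H \<Longrightarrow> coprime_indicator H (U * A) = coprime_indicator H A"
  by (simp add: coprime_indicator_def)

text \<open>Multiplying all entries by the unit \<open>U\<close> permutes the tuples of units and
  multiplies their sum by \<open>U\<close>.\<close>

lemma unit_conv_coprime_indicator_scale:
  fixes H :: "'a::{finite_field,field_gcd} poly"
  assumes "coprime U H"
  shows "unit_conv H (coprime_indicator H) n (U * A) = unit_conv H (coprime_indicator H) n A"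
proof (induction n arbitrary: A)
  case (Suc n)
  let ?u = "unit_conv H (coprime_indicator H) n"
  have "periodic_mod H (\<lambda>K. coprime_indicator H K * ?u (U * A - K))"
    by (intro periodic_mod_mult periodic_coprime_indicator periodic_mod_reflect periodic_unit_conv)
  from sum_residue_reps_scale[OF this assms]
  have "unit_conv H (coprime_indicator H) (Suc n) (U * A) =
        (\<Sum>K\<in>residue_reps H. coprime_indicator H (U * K) * ?u (U * A - U * K))" by simp
  also have "\<dots> = unit_conv H (coprime_indicator H) (Suc n) A"
    using Suc.IH assms by (simp add: coprime_indicator_unit_mult flip: right_diff_distrib)
  finally show ?case .
qed (simp add: assms coprime_indicator_unit_mult)

text \<open>By scaling, each unit is the sum of equally many unit tuples, so the total is the count
  for the sum 1 times the number of units.\<close>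

lemma euler_phi_tuples_eq:
  fixes H :: "'a::{finite_field,field_gcd} poly"
  assumes "H \<noteq> 0" "l \<ge> 1"
  shows "of_nat (euler_phi_tuples l H) =
         of_real (euler_phi H) * unit_conv H (coprime_indicator H) (l - 1) 1"
proof -
  let ?u = "unit_conv H (coprime_indicator H) (l - 1)"
  have "(of_nat (euler_phi_tuples l H) :: complex) =
        (\<Sum>K \<in> {K \<in> {1..l} \<rightarrow>\<^sub>E residue_reps H.
                coprime (\<Sum>i=1..l. K i) H \<and> coprime (\<Prod>i=1..l. K i) H}. 1)"
    by (simp add: euler_phi_tuples_def conj_commute)
  also have "\<dots> = (\<Sum>K \<in> {K \<in> {1..l} \<rightarrow>\<^sub>E residue_reps H.
                coprime (\<Sum>i=1..l. K i) H \<and> coprime (\<Prod>i=1..l. K i) H}. coprime_indicator H (K 1) * 1)"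
    using assms(2) by (intro sum.cong refl) (auto simp: coprime_indicator_def coprime_prod_left_iff)
  also have "\<dots> = (\<Sum>A\<in>residue_reps H. coprime_indicator H A * 1 * ?u A)"
    using assms
    by (intro sum_unit_tuples periodic_coprime_indicator) (auto simp: coprime_indicator_def periodic_mod_def)
  also have "\<dots> = (\<Sum>A\<in>residue_reps H. coprime_indicator H A * ?u 1)"
  proof (intro sum.cong refl)
    fix A
    show "coprime_indicator H A * 1 * ?u A = coprime_indicator H A * ?u 1"
      using unit_conv_coprime_indicator_scale[of A H "l - 1" 1] by (auto simp: coprime_indicator_def)
  qed
  also have "\<dots> = of_real (euler_phi H) * ?u 1"
    using assms by (simp add: sum_coprime_indicator flip: sum_distrib_right)
  finally show ?thesis .
qed

subsection \<open>Units in a residue class of a divisor of the modulus\<close>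

lemma coprime_iff_no_common_prime:
  fixes A H :: "'a::{finite_field,field_gcd} poly"
  assumes "H \<noteq> 0"
  shows "coprime A H \<longleftrightarrow> (\<forall>P. prime P \<longrightarrow> P dvd H \<longrightarrow> \<not>P dvd A)"
proof
  assume "coprime A H"
  thus "\<forall>P. prime P \<longrightarrow> P dvd H \<longrightarrow> \<not>P dvd A"
    using coprime_common_divisor not_prime_unit by blast
next
  assume *: "\<forall>P. prime P \<longrightarrow> P dvd H \<longrightarrow> \<not>P dvd A"
  show "coprime A H"
  proof (rule ccontr)
    assume "\<not>coprime A H"
    hence "\<not>is_unit (gcd A H)" by (subst is_unit_gcd)
    then obtain P where "prime P" "P dvd gcd A H"
      using prime_divisor_exists[of "gcd A H"] assms by auto
    thus False using * by auto
  qed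
qed

text \<open>Add to \<open>S\<close> the multiple of \<open>M\<close> by the product of those primes
  of \<open>H\<close> that do not divide \<open>S\<close>. Each prime of \<open>H\<close> then
  divides exactly one of the two summands.\<close>

lemma lift_unit:
  fixes S M H :: "'a::{finite_field,field_gcd} poly"
  assumes "coprime S M" "H \<noteq> 0"
  obtains S' where "[S' = S] (mod M)" "coprime S' H"
proof -
  define X where "X = {P \<in> monic_irreducible_divisors H. \<not>P dvd S}"
  have X: "finite X" using assms by (simp add: X_def)
  have "\<not>P dvd S + \<Prod>X * M" if P: "prime P" "P dvd H" for P
  proof (cases "P dvd S")
    case True
    hence "\<not>P dvd M" using assms(1) P not_prime_unit coprime_common_divisor by blast
    moreover have "\<not>P dvd \<Prod>X"
    proof
      assume "P dvd \<Prod>X"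
      then obtain Q where "Q \<in> X" "P dvd Q" using P X by (auto simp: prime_dvd_prod_iff)
      moreover from this have "P = Q"
        using P by (intro primes_dvd_imp_eq) (auto simp: X_def monic_irreducible_divisors_eq)
      ultimately show False using True by (simp add: X_def)
    qed
    ultimately show ?thesis using True P by (simp add: dvd_add_right_iff prime_dvd_mult_iff)
  next
    case False
    hence "P \<in> X" using P by (simp add: X_def monic_irreducible_divisors_eq)
    hence "P dvd \<Prod>X" using X by (intro dvd_prodI)
    thus ?thesis using False by (simp add: dvd_add_left_iff)
  qed
  hence "coprime (S + \<Prod>X * M) H" using assms(2) by (simp add: coprime_iff_no_common_prime)
  moreover have "[S + \<Prod>X * M = S] (mod M)" by (simp add: cong_iff_dvd_diff)
  ultimately show ?thesis using that by blast
qed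

text \<open>Double counting: the number of units of \<open>H\<close> in a class modulo
  \<open>M\<close> is the same for all unit classes, by scaling and \<open>lift_unit\<close>, and 0
  for the others. Summed over all classes it gives \<open>euler_phi H\<close>.\<close>

lemma sum_units_in_class:
  fixes S M H :: "'a::{finite_field,field_gcd} poly"
  assumes "M dvd H" "H \<noteq> 0" "coprime S H"
  shows "(\<Sum>A\<in>residue_reps H. if M dvd A - S then coprime_indicator H A else 0) =
         of_real (euler_phi H / euler_phi M)"
proof -
  define n where "n = (\<lambda>S. \<Sum>A\<in>residue_reps H. if M dvd A - S then coprime_indicator H A else 0)"
  have M0: "M \<noteq> 0" using assms by auto
  have n_cong: "n S = n S'" if "[S = S'] (mod M)" for S S'
  proof -
    have "M dvd A - S \<longleftrightarrow> M dvd A - S'" for A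
      using that by (metis cong_iff_dvd_diff cong_sym cong_trans)
    thus ?thesis by (simp add: n_def)
  qed
  have n_unit: "n S = n 1" if S: "coprime S H" for S
  proof -
    let ?f = "\<lambda>A. if M dvd A - S then coprime_indicator H A else 0"
    have "periodic_mod H ?f"
    proof (rule periodic_modI)
      fix A B assume AB: "[A = B] (mod H)"
      hence "[A - S = B - S] (mod M)" using assms(1) by (auto intro: cong_diff cong_dvd_modulus)
      hence "M dvd A - S \<longleftrightarrow> M dvd B - S" by (simp add: cong_dvd_iff)
      thus "?f A = ?f B" using periodic_modD[OF periodic_coprime_indicator AB] by simp
    qed
    from sum_residue_reps_scale[OF this S]
    have "n S = (\<Sum>A\<in>residue_reps H. ?f (S * A))" by (simp add: n_def)
    also have "\<dots> = n 1" unfolding n_def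
    proof (intro sum.cong refl)
      fix A
      have "coprime M S" using S assms(1) coprime_commute coprime_divisors dvd_refl by metis
      hence "M dvd S * (A - 1) \<longleftrightarrow> M dvd A - 1" by (simp add: coprime_dvd_mult_right_iff)
      thus "?f (S * A) = (if M dvd A - 1 then coprime_indicator H A else 0)"
        using S by (simp add: right_diff_distrib coprime_indicator_unit_mult)
    qed
    finally show ?thesis .
  qed
  have n_eq: "n S = coprime_indicator M S * n 1" for S
  proof (cases "coprime S M")
    case True
    then obtain S' where "[S' = S] (mod M)" "coprime S' H" using assms(2) by (rule lift_unit)
    thus ?thesis using n_cong[of S' S] n_unit[of S'] True by (simp add: coprime_indicator_def)
  next
    case False
    have "coprime_indicator H A = 0" if "M dvd A - S" for A
    proof -
      have "[A = S] (mod M)" using that by (simp add: cong_iff_dvd_diff)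
      hence "\<not>coprime A M" using False by (simp add: cong_coprime_iff)
      hence "\<not>coprime A H" using assms(1) coprime_divisors dvd_refl by blast
      thus ?thesis by (simp add: coprime_indicator_def)
    qed
    hence "n S = 0" unfolding n_def by (intro sum.neutral) auto
    thus ?thesis using False by (simp add: coprime_indicator_def)
  qed
  have "of_real (euler_phi M) * n 1 = (\<Sum>S\<in>residue_reps M. n S)"
    by (subst n_eq) (simp add: sum_coprime_indicator M0 flip: sum_distrib_right)
  also have "\<dots> = (\<Sum>A\<in>residue_reps H. \<Sum>S\<in>residue_reps M. if M dvd A - S then coprime_indicator H A else 0)"
    unfolding n_def by (rule sum.swap)
  \<comment> \<open>Each \<open>A\<close> lies in exactly one class modulo \<open>M\<close>, so the
    inner sum is the norm of \<open>M div M\<close>, which is 1.\<close>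
  also have "\<dots> = (\<Sum>A\<in>residue_reps H. coprime_indicator H A * (\<Sum>S\<in>residue_reps M. if M dvd A - S then 1 else 0))"
    by (auto simp: sum_distrib_left intro!: sum.cong)
  also have "\<dots> = of_real (euler_phi H)"
    using M0 assms by (simp add: sum_dvd_diff_indicator sum_coprime_indicator poly_norm_def)
  finally have "of_real (euler_phi M) * n 1 = of_real (euler_phi H)" .
  hence "n S = of_real (euler_phi H / euler_phi M)"
    using n_unit[OF assms(3)] euler_phi_pos[of M] by (simp add: field_simps)
  thus ?thesis by (simp add: n_def)
qed

subsection \<open>Dirichlet characters\<close>

lemma dirichlet_characterD:
  assumes "dirichlet_character H \<chi>"
  shows "periodic_mod H \<chi>" "\<chi> (A * B) = \<chi> A * \<chi> B" "\<chi> A \<noteq> 0 \<longleftrightarrow> coprime A H" "\<chi> 1 = 1"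
proof -
  show "\<chi> (A * B) = \<chi> A * \<chi> B" "\<chi> A \<noteq> 0 \<longleftrightarrow> coprime A H"
    using assms by (auto simp: dirichlet_character_def)
  show "periodic_mod H \<chi>"
  proof (rule periodic_modI)
    fix A B assume "[A = B] (mod H)"
    then obtain K where K: "A - B = H * K" by (auto simp: cong_iff_dvd_diff)
    have "A = B + K * H" using K by (simp add: algebra_simps)
    thus "\<chi> A = \<chi> B" using assms by (simp add: dirichlet_character_def)
  qed
  have "\<chi> 1 \<noteq> 0" "\<chi> (1 * 1) = \<chi> 1 * \<chi> 1"
    using assms coprime_1_left unfolding dirichlet_character_def by blast+
  thus "\<chi> 1 = 1" by simp
qed

lemma not_induced_modulusE:
  fixes H :: "'a::{finite_field,field_gcd} poly"
  assumes \<chi>: "dirichlet_character H \<chi>" and M: "lead_coeff M = 1" "M dvd H" "\<not>induced_modulus H \<chi> M"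
  obtains U where "coprime U H" "[U = 1] (mod M)" "\<chi> U \<noteq> 1"
proof -
  obtain A B where AB: "coprime A H" "coprime B H" "[A = B] (mod M)" "\<chi> A \<noteq> \<chi> B"
    using M unfolding induced_modulus_def by blast
  \<comment> \<open>With \<open>V\<close> an inverse of \<open>B\<close>, the witness
    \<open>A * V\<close> is 1 modulo \<open>M\<close>, while its character value is the quotient of
    the distinct values at \<open>A\<close> and \<open>B\<close>.\<close>
  obtain V where V: "[B * V = 1] (mod H)" "coprime V H"
    using AB(2) by (rule coprime_imp_inverse_mod)
  have "[A * V = B * V] (mod M)" using AB(3) by (rule cong_scalar_right)
  also have "[B * V = 1] (mod M)" using V(1) M(2) by (rule cong_dvd_modulus)
  finally have U: "[A * V = 1] (mod M)" .
  have "\<chi> B * \<chi> V = 1"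
    using periodic_modD[OF dirichlet_characterD(1)[OF \<chi>] V(1)] dirichlet_characterD[OF \<chi>] by simp
  hence "\<chi> (A * V) \<noteq> 1"
    using AB(4) V(2) dirichlet_characterD[OF \<chi>] by (metis mult_right_cancel)
  thus ?thesis using that[of "A * V"] U AB(1) V(2) by simp
qed

text \<open>Multiplication by \<open>U\<close> permutes the residue class, so the sum is invariant under the factor \<open>\<theta> U \<noteq> 1\<close>.\<close>

lemma sum_character_class_eq_0:
  fixes N :: "'a::{finite_field,field_gcd} poly" and \<theta> :: "'a poly \<Rightarrow> complex"
  assumes \<theta>: "periodic_mod N \<theta>" "\<And>A B. \<theta> (A * B) = \<theta> A * \<theta> B"
    and U: "coprime U N" "[U = 1] (mod E)" "\<theta> U \<noteq> 1" and "E dvd N"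
  shows "(\<Sum>C\<in>residue_reps N. if E dvd A - C then \<theta> C else 0) = 0"
proof -
  let ?f = "\<lambda>C. if E dvd A - C then \<theta> C else 0"
  have "periodic_mod N ?f"
  proof (rule periodic_modI)
    fix B C assume BC: "[B = C] (mod N)"
    hence "[A - B = A - C] (mod E)" using assms(6) by (auto intro: cong_diff cong_dvd_modulus)
    hence "E dvd A - B \<longleftrightarrow> E dvd A - C" by (rule cong_dvd_iff)
    thus "?f B = ?f C" using periodic_modD[OF \<theta>(1) BC] by simp
  qed
  from sum_residue_reps_scale[OF this U(1)]
  have "(\<Sum>C\<in>residue_reps N. ?f C) = (\<Sum>C\<in>residue_reps N. ?f (U * C))" ..
  also have "\<dots> = (\<Sum>C\<in>residue_reps N. \<theta> U * ?f C)"
  proof (intro sum.cong refl)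
    fix C
    have "[A - U * C = A - 1 * C] (mod E)" using U(2) by (intro cong_diff cong_scalar_right) auto
    hence "E dvd A - U * C \<longleftrightarrow> E dvd A - C" by (simp add: cong_dvd_iff)
    thus "?f (U * C) = \<theta> U * ?f C" by (simp add: \<theta>(2))
  qed
  also have "\<dots> = \<theta> U * (\<Sum>C\<in>residue_reps N. ?f C)" by (simp add: sum_distrib_left)
  finally show ?thesis using U(3) by simp
qed

text \<open>\<open>H1\<close> stands for \<open>H div H0\<close>; its irreducible factors are those
  of \<open>H\<close> that do not divide \<open>D\<close>.\<close>

locale character_with_conductor =
  fixes H D H0 H1 :: "'a::{finite_field,field_gcd} poly" and \<chi> \<psi> :: "'a poly \<Rightarrow> complex"
  assumes H_nz: "H \<noteq> 0"
    and chi: "dirichlet_character H \<chi>"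
    and conductor: "is_conductor H \<chi> D"
    and psi: "dirichlet_character D \<psi>"
    and chi_eq_psi: "\<And>A. coprime A H \<Longrightarrow> \<chi> A = \<psi> A"
    and H_eq: "H = H0 * H1"
    and H0_primes: "monic_irreducible_divisors H0 = monic_irreducible_divisors D"
    and H0_coprime: "coprime H0 H1"
begin

lemma nz [simp]: "H0 \<noteq> 0" "H1 \<noteq> 0" "D \<noteq> 0"
  using H_nz H_eq conductor by (auto simp: is_conductor_def induced_modulus_def)

lemma D_monic: "lead_coeff D = 1" and D_dvd_H: "D dvd H"
  using conductor by (auto simp: is_conductor_def induced_modulus_def)

lemma coprime_H0_iff: "coprime A H0 \<longleftrightarrow> coprime A D"
  using H0_primes by (auto simp: coprime_iff_no_common_prime monic_irreducible_divisors_eq set_eq_iff)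

text \<open>\<open>H1\<close> has no prime in common with \<open>H0\<close>, hence none with
  \<open>D\<close>, so \<open>D\<close> divides the other factor of \<open>H\<close>.\<close>

lemma D_dvd_H0: "D dvd H0"
proof -
  have "coprime H1 H0" using H0_coprime by (simp add: coprime_commute)
  hence "coprime H1 D" by (simp only: coprime_H0_iff)
  hence "coprime D H1" by (simp add: coprime_commute)
  thus ?thesis using D_dvd_H unfolding H_eq by (simp add: coprime_dvd_mult_left_iff)
qed

lemma psi_periodic_H0: "periodic_mod H0 \<psi>"
  by (rule periodic_mod_dvd[OF dirichlet_characterD(1)[OF psi] D_dvd_H0])

lemma unit_outside_conductorE:
  assumes "lead_coeff M = 1" "M dvd H" "\<not>D dvd M"
  obtains U where "coprime U H" "[U = 1] (mod M)" "\<chi> U \<noteq> 1"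
proof -
  have "\<not>induced_modulus H \<chi> M" using conductor assms(3) by (auto simp: is_conductor_def)
  with chi assms(1,2) show ?thesis using that by (rule not_induced_modulusE)
qed

text \<open>If \<open>D\<close> divides \<open>E\<close>, then \<open>\<psi>\<close> is constant on
  the class of \<open>A\<close> modulo \<open>E\<close>. Otherwise \<open>E\<close> is not an
  induced modulus, and a unit \<open>U\<close> congruent to 1 modulo \<open>E\<close> with
  \<open>\<psi> U\<close> different from 1 makes the sum vanish.\<close>

lemma sum_psi_class:
  assumes E: "lead_coeff E = 1" "E dvd H0"
  shows "(\<Sum>C\<in>residue_reps H0. if E dvd A - C then \<psi> C else 0) =
         (if D dvd E then of_real (poly_norm (H0 div E)) * \<psi> A else 0)"
proof (cases "D dvd E")
  case True
  have psi_eq: "\<psi> C = \<psi> A" if "E dvd A - C" for C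
  proof -
    have "[A = C] (mod D)" using that True dvd_trans by (auto simp: cong_iff_dvd_diff)
    thus ?thesis using periodic_modD[OF dirichlet_characterD(1)[OF psi]] by metis
  qed
  have "(if E dvd A - C then \<psi> C else 0) = (if E dvd A - C then 1 else 0) * \<psi> A" for C
    using psi_eq[of C] by auto
  hence "(\<Sum>C\<in>residue_reps H0. if E dvd A - C then \<psi> C else 0) =
         (\<Sum>C\<in>residue_reps H0. (if E dvd A - C then 1 else 0) * \<psi> A)"
    by (rule sum.cong[OF refl])
  thus ?thesis using True E sum_dvd_diff_indicator[OF E(2), of A]
    by (simp flip: sum_distrib_right)
next
  case False
  obtain U where U: "coprime U H" "[U = 1] (mod E)" "\<chi> U \<noteq> 1"
    using unit_outside_conductorE[of E] E False dvd_mult2[of E H0 H1] unfolding H_eq by blast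
  have "(\<Sum>C\<in>residue_reps H0. if E dvd A - C then \<psi> C else 0) = 0"
    using U E(2) chi_eq_psi[OF U(1)]
    by (intro sum_character_class_eq_0[of _ _ U] psi_periodic_H0 dirichlet_characterD(2)[OF psi])
       (auto simp: H_eq)
  thus ?thesis using False by simp
qed

text \<open>
  After Moebius inversion only squarefree \<open>E\<close> with \<open>D dvd E dvd H0\<close> contribute, and \<open>D\<close> is the only
  candidate because \<open>D\<close> and \<open>H0\<close> have the same irreducible factors.
\<close>

lemma sum_psi_reflected_units:
  "(\<Sum>K\<in>residue_reps H0. coprime_indicator H0 K * \<psi> (A - K)) =
   moebius D * of_real (poly_norm (H0 div D)) * \<psi> A"
proof -
  let ?Dv = "{E. lead_coeff E = 1 \<and> E dvd H0}" and ?R = "residue_reps H0"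
  have "(\<Sum>K\<in>?R. coprime_indicator H0 K * \<psi> (A - K)) =
        (\<Sum>K\<in>?R. \<Sum>E\<in>?Dv. moebius E * (if E dvd K then \<psi> (A - K) else 0))"
    by (auto simp: coprime_indicator_eq_sum_moebius sum_distrib_right intro!: sum.cong)
  also have "\<dots> = (\<Sum>E\<in>?Dv. moebius E * (\<Sum>K\<in>?R. if E dvd K then \<psi> (A - K) else 0))"
    by (subst sum.swap) (simp add: sum_distrib_left)
  also have "\<dots> = (\<Sum>E\<in>?Dv. if E = D then moebius D * of_real (poly_norm (H0 div D)) * \<psi> A else 0)"
  proof (intro sum.cong refl)
    fix E assume E: "E \<in> ?Dv"
    have "periodic_mod H0 (\<lambda>K. if E dvd K then \<psi> (A - K) else 0)"
    proof (rule periodic_modI)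
      fix B C assume BC: "[B = C] (mod H0)"
      hence "[B = C] (mod E)" using E by (auto intro: cong_dvd_modulus)
      hence "E dvd B \<longleftrightarrow> E dvd C" by (rule cong_dvd_iff)
      thus "(if E dvd B then \<psi> (A - B) else 0) = (if E dvd C then \<psi> (A - C) else 0)"
        using periodic_modD[OF periodic_mod_reflect[OF psi_periodic_H0] BC] by simp
    qed
    \<comment> \<open>Reflecting the summation variable at \<open>A\<close> turns the sum over
      multiples of \<open>E\<close> into a sum of \<open>\<psi>\<close> over the class of
      \<open>A\<close> modulo \<open>E\<close>.\<close>
    hence "(\<Sum>K\<in>?R. if E dvd K then \<psi> (A - K) else 0) =
           (\<Sum>C\<in>?R. if E dvd A - C then \<psi> (A - (A - C)) else 0)"
      by (rule sum_residue_reps_reflect [symmetric])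
    also have "\<dots> = (\<Sum>C\<in>?R. if E dvd A - C then \<psi> C else 0)"
      by (rule sum.cong[OF refl]) (simp add: diff_diff_eq2)
    also have "\<dots> = (if D dvd E then of_real (poly_norm (H0 div E)) * \<psi> A else 0)"
      using E by (intro sum_psi_class) auto
    finally have eq: "(\<Sum>K\<in>?R. if E dvd K then \<psi> (A - K) else 0) =
      (if D dvd E then of_real (poly_norm (H0 div E)) * \<psi> A else 0)" .
    have "E = D" if DE: "D dvd E" and mu: "moebius E \<noteq> 0"
    proof -
      have fin: "finite (monic_irreducible_divisors E)"
        and E_eq: "E = \<Prod>(monic_irreducible_divisors E)"
        using moebius_nonzeroE[OF mu] E by auto
      have "monic_irreducible_divisors E \<subseteq> monic_irreducible_divisors H0"
        using E dvd_trans by (auto simp: monic_irreducible_divisors_def)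
      hence "E dvd D" using prod_primes_dvd[OF fin, of D] E_eq H0_primes by auto
      moreover have "normalize E = E" "normalize D = D"
        using E D_monic by (auto simp: normalize_poly_eq_iff_monic monic_neq_0)
      ultimately show "E = D" using DE by (metis associatedI)
    qed
    thus "moebius E * (\<Sum>K\<in>?R. if E dvd K then \<psi> (A - K) else 0) =
          (if E = D then moebius D * of_real (poly_norm (H0 div D)) * \<psi> A else 0)"
      unfolding eq by auto
  qed
  also have "\<dots> = moebius D * of_real (poly_norm (H0 div D)) * \<psi> A"
    using D_monic D_dvd_H0 by (subst sum.delta) auto
  finally show ?thesis .
qed

text \<open>\<open>\<psi>\<close> already vanishes off the units modulo \<open>D\<close>,
  equivalently modulo \<open>H0\<close>; the indicator adds the condition modulo
  \<open>H1\<close>.\<close>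

lemma chi_eq: "\<chi> A = \<psi> A * coprime_indicator H1 A"
proof (cases "coprime A H")
  case True
  thus ?thesis using chi_eq_psi[OF True] by (simp add: H_eq coprime_indicator_def)
next
  case False
  hence "\<chi> A = 0" using dirichlet_characterD(3)[OF chi] by blast
  moreover have "\<psi> A = 0 \<or> \<not>coprime A H1"
    using False dirichlet_characterD(3)[OF psi, of A] by (auto simp: H_eq coprime_H0_iff)
  ultimately show ?thesis by (auto simp: coprime_indicator_def)
qed

text \<open>Each convolution step splits by the Chinese remainder theorem: modulo \<open>H0\<close>
  it multiplies \<open>\<psi>\<close> by a constant, by \<open>sum_psi_reflected_units\<close>;
  modulo \<open>H1\<close> it is one more step of the unit count.\<close>

lemma unit_conv_chi:
  "unit_conv H \<chi> n A = (moebius D * of_real (poly_norm (H0 div D))) ^ n * \<psi> A *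
                       unit_conv H1 (coprime_indicator H1) n A"
proof (induction n arbitrary: A)
  case 0
  show ?case by (simp add: chi_eq)
next
  case (Suc n)
  let ?c = "moebius D * of_real (poly_norm (H0 div D))"
  let ?u = "unit_conv H1 (coprime_indicator H1) n"
  have "unit_conv H \<chi> (Suc n) A =
        ?c ^ n * (\<Sum>K\<in>residue_reps (H0 * H1). (coprime_indicator H0 K * \<psi> (A - K)) *
                     (coprime_indicator H1 K * ?u (A - K)))"
    unfolding unit_conv.simps Suc.IH sum_distrib_left unfolding H_eq
    by (intro sum.cong refl) (simp add: coprime_indicator_mult)
  also have "(\<Sum>K\<in>residue_reps (H0 * H1). (coprime_indicator H0 K * \<psi> (A - K)) *
                     (coprime_indicator H1 K * ?u (A - K))) =
             (\<Sum>K\<in>residue_reps H0. coprime_indicator H0 K * \<psi> (A - K)) *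
             (\<Sum>K\<in>residue_reps H1. coprime_indicator H1 K * ?u (A - K))"
    using H0_coprime
    by (intro sum_residue_reps_coprime_mult periodic_mod_mult periodic_coprime_indicator
          periodic_mod_reflect psi_periodic_H0 periodic_unit_conv) auto
  also have "?c ^ n * \<dots> = ?c ^ Suc n * \<psi> A * unit_conv H1 (coprime_indicator H1) (Suc n) A"
    by (simp add: sum_psi_reflected_units)
  finally show ?case .
qed

text \<open>If \<open>D\<close> divides \<open>M\<close>, all units in the class share the value
  \<open>\<psi> S\<close> and only their number matters. Otherwise the sum vanishes as in
  \<open>sum_psi_class\<close>.\<close>

lemma sum_chi_class:
  assumes S: "coprime S H" and M: "lead_coeff M = 1" "M dvd H"
  shows "(\<Sum>A\<in>residue_reps H. if M dvd A - S then \<chi> A else 0) =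
         (if D dvd M then \<psi> S * of_real (euler_phi H / euler_phi M) else 0)"
proof (cases "D dvd M")
  case True
  have "\<chi> A = coprime_indicator H A * \<psi> S" if "M dvd A - S" for A
  proof (cases "coprime A H")
    case cop: True
    have "[A = S] (mod D)" using that True dvd_trans by (auto simp: cong_iff_dvd_diff)
    hence "\<psi> A = \<psi> S" using periodic_modD[OF dirichlet_characterD(1)[OF psi]] by metis
    thus ?thesis using chi_eq_psi[OF cop] cop by (simp add: coprime_indicator_def)
  next
    case False
    thus ?thesis using dirichlet_characterD(3)[OF chi, of A] by (simp add: coprime_indicator_def)
  qed
  hence "(\<Sum>A\<in>residue_reps H. if M dvd A - S then \<chi> A else 0) =
         (\<Sum>A\<in>residue_reps H. (if M dvd A - S then coprime_indicator H A else 0) * \<psi> S)"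
    by (intro sum.cong) auto
  thus ?thesis using True sum_units_in_class[OF M(2) H_nz S]
    by (simp flip: sum_distrib_right)
next
  case False
  obtain U where U: "coprime U H" "[U = 1] (mod M)" "\<chi> U \<noteq> 1"
    using unit_outside_conductorE[of M] M False by blast
  have "(\<Sum>A\<in>residue_reps H. if M dvd S - A then \<chi> A else 0) = 0"
    using U M(2) by (intro sum_character_class_eq_0[of _ _ U] dirichlet_characterD(1,2)[OF chi])
  moreover have "M dvd S - A \<longleftrightarrow> M dvd A - S" for A by (rule dvd_diff_commute)
  ultimately show ?thesis using False by simp
qed

text \<open>With \<open>H0 = D * Q\<close> the argument is \<open>H0 * Q ^ n\<close>. It has the
  same primes as \<open>H0\<close>, so only the norm changes.\<close>

lemma euler_phi_quotient:
  "euler_phi (H0 ^ Suc n div D ^ n) = poly_norm (H0 div D) ^ n * euler_phi H0"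
proof -
  obtain Q where Q: "H0 = D * Q" using D_dvd_H0 by (elim dvdE)
  have Q0: "Q \<noteq> 0" using Q nz(1) by auto
  have eq: "H0 ^ Suc n div D ^ n = H0 * Q ^ n"
  proof -
    have "H0 ^ Suc n = D ^ n * (H0 * Q ^ n)"
      by (simp add: Q power_mult_distrib mult_ac)
    thus ?thesis by simp
  qed
  have "monic_irreducible_divisors (H0 * Q ^ n) = monic_irreducible_divisors H0"
  proof (intro equalityI subsetI)
    fix P assume "P \<in> monic_irreducible_divisors (H0 * Q ^ n)"
    hence P: "prime P" "P dvd H0 \<or> P dvd Q"
      by (auto simp: monic_irreducible_divisors_eq prime_dvd_mult_iff dest: prime_dvd_power)
    hence "P dvd H0" by (auto simp: Q)
    thus "P \<in> monic_irreducible_divisors H0" using P by (simp add: monic_irreducible_divisors_eq)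
  qed (auto simp: monic_irreducible_divisors_def)
  moreover have "H0 div D = Q" by (simp add: Q)
  ultimately show ?thesis
    unfolding eq using Q0 by (simp add: euler_phi_def poly_norm_mult poly_norm_power)
qed

end

subsection \<open>The sum over the additive variables\<close>

text \<open>Moebius inversion turns \<open>F\<close> at the gcd into a sum over common divisors
  \<open>M\<close>. For fixed \<open>M\<close> the conditions on the \<open>B i\<close> are
  independent, so the sum over tuples is a product of single character sums.\<close>

lemma sum_gcd_additive_characters:
  fixes H X :: "'a::{finite_field,field_gcd} poly"
  assumes "H \<noteq> 0"
  shows "(\<Sum>B \<in> {1..s} \<rightarrow>\<^sub>E residue_reps H. F (Gcd ({X} \<union> B ` {1..s} \<union> {H})) *
            (\<Prod>i=1..s. additive_character (W i) H (B i))) =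
         (\<Sum>M | lead_coeff M = 1 \<and> M dvd H. if M dvd X \<and> (\<forall>i\<in>{1..s}. H div M dvd W i)
            then dirichlet_conv moebius F M * of_real (poly_norm (H div M)) ^ s else 0)"
proof -
  let ?Dv = "{M. lead_coeff M = 1 \<and> M dvd H}" and ?Pi = "{1..s} \<rightarrow>\<^sub>E residue_reps H"
  let ?lam = "\<lambda>i. additive_character (W i) H" and ?c = "dirichlet_conv moebius F"
  have F_eq: "F (Gcd ({X} \<union> B ` {1..s} \<union> {H})) =
        (\<Sum>M\<in>?Dv. if M dvd X \<and> (\<forall>i\<in>{1..s}. M dvd B i) then ?c M else 0)" for B
  proof -
    let ?G = "Gcd ({X} \<union> B ` {1..s} \<union> {H})"
    have "?G dvd H" by (intro Gcd_dvd) simp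
    hence "?G \<noteq> 0" using assms by auto
    hence "lead_coeff ?G = 1" by (subst normalize_poly_eq_iff_monic [symmetric]) simp_all
    hence "F ?G = (\<Sum>M | lead_coeff M = 1 \<and> M dvd ?G. ?c M)"
      by (rule sum_dirichlet_conv_moebius [symmetric])
    also have "{M. lead_coeff M = 1 \<and> M dvd ?G} = {M \<in> ?Dv. M dvd X \<and> (\<forall>i\<in>{1..s}. M dvd B i)}"
      unfolding dvd_Gcd_iff by auto
    also have "sum ?c \<dots> = (\<Sum>M\<in>?Dv. if M dvd X \<and> (\<forall>i\<in>{1..s}. M dvd B i) then ?c M else 0)"
      using assms by (intro sum.inter_filter) simp
    finally show ?thesis .
  qed
  have "(\<Sum>B\<in>?Pi. F (Gcd ({X} \<union> B ` {1..s} \<union> {H})) * (\<Prod>i=1..s. ?lam i (B i))) =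
        (\<Sum>B\<in>?Pi. \<Sum>M\<in>?Dv. (if M dvd X then ?c M else 0) *
            (\<Prod>i=1..s. if M dvd B i then ?lam i (B i) else 0))"
    unfolding F_eq sum_distrib_right
  proof (intro sum.cong refl)
    fix B and M :: "'a poly"
    have "(\<Prod>i=1..s. if M dvd B i then ?lam i (B i) else 0) =
          (if \<forall>i\<in>{1..s}. M dvd B i then \<Prod>i=1..s. ?lam i (B i) else 0)"
      by (auto intro!: prod.cong prod_zero)
    thus "(if M dvd X \<and> (\<forall>i\<in>{1..s}. M dvd B i) then ?c M else 0) * (\<Prod>i=1..s. ?lam i (B i)) =
          (if M dvd X then ?c M else 0) * (\<Prod>i=1..s. if M dvd B i then ?lam i (B i) else 0)"
      by auto
  qed
  also have "\<dots> = (\<Sum>M\<in>?Dv. (if M dvd X then ?c M else 0) *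
      (\<Sum>B\<in>?Pi. \<Prod>i=1..s. if M dvd B i then ?lam i (B i) else 0))"
    by (subst sum.swap) (simp add: sum_distrib_left)
  also have "\<dots> = (\<Sum>M\<in>?Dv. (if M dvd X then ?c M else 0) *
      (\<Prod>i=1..s. if H div M dvd W i then of_real (poly_norm (H div M)) else 0))"
  proof (intro sum.cong refl arg_cong2[of _ _ _ _ "(*)"])
    fix M assume M: "M \<in> ?Dv"
    have "(\<Sum>B\<in>?Pi. \<Prod>i=1..s. if M dvd B i then ?lam i (B i) else 0) =
          (\<Prod>i=1..s. \<Sum>b\<in>residue_reps H. if M dvd b then ?lam i b else 0)"
      using assms by (subst prod_sum_PiE) auto
    also have "\<dots> = (\<Prod>i=1..s. if H div M dvd W i then of_real (poly_norm (H div M)) else 0)"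
      using M assms by (intro prod.cong refl sum_additive_character_multiples) auto
    finally show "(\<Sum>B\<in>?Pi. \<Prod>i=1..s. if M dvd B i then ?lam i (B i) else 0) = \<dots>" .
  qed
  also have "\<dots> = (\<Sum>M\<in>?Dv. if M dvd X \<and> (\<forall>i\<in>{1..s}. H div M dvd W i)
            then ?c M * of_real (poly_norm (H div M)) ^ s else 0)"
  proof (intro sum.cong refl)
    fix M :: "'a poly"
    have "(\<Prod>i=1..s. if H div M dvd W i then of_real (poly_norm (H div M)) else 0) =
          (if \<forall>i\<in>{1..s}. H div M dvd W i then of_real (poly_norm (H div M)) ^ s else (0::complex))"
      by (auto intro!: prod_zero)
    thus "(if M dvd X then ?c M else 0) *
          (\<Prod>i=1..s. if H div M dvd W i then of_real (poly_norm (H div M)) else 0) =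
          (if M dvd X \<and> (\<forall>i\<in>{1..s}. H div M dvd W i)
            then ?c M * of_real (poly_norm (H div M)) ^ s else 0)" by auto
  qed
  finally show ?thesis .
qed

section \<open>Assembly of the formula\<close>

theorem theorem1p2:
  fixes H D H0 S :: "'a::{finite_field,field_gcd} poly"
    and l s :: nat
    and \<chi> \<psi> F :: "'a poly \<Rightarrow> complex"
    and W :: "nat \<Rightarrow> 'a poly"
  assumes "H \<noteq> 0"
    and "l \<ge> 1"
    and "dirichlet_character H \<chi>"
    and "is_conductor H \<chi> D"
    and "primitive_character D \<psi>"
    and "\<And>A. coprime A H \<Longrightarrow> \<chi> A = \<psi> A"
    and "\<And>i. i \<in> {1..s} \<Longrightarrow> W i = 0 \<or> degree (W i) < degree H"
    and "coprime S H"
    and "lead_coeff H0 = 1"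
    and "H0 dvd H"
    and "monic_irreducible_divisors H0 = monic_irreducible_divisors D"
    and "coprime H0 (H div H0)"
  shows
    "(\<Sum>K \<in> {K \<in> {1..l} \<rightarrow>\<^sub>E residue_reps H.
                coprime (\<Sum>i=1..l. K i) H \<and> coprime (\<Prod>i=1..l. K i) H}.
        \<Sum>B \<in> {1..s} \<rightarrow>\<^sub>E residue_reps H.
          F (Gcd ({(\<Sum>i=1..l. K i) - S} \<union> B ` {1..s} \<union> {H})) * \<chi> (K 1) *
          (\<Prod>i=1..s. additive_character (W i) H (B i))) =
     moebius D ^ (l - 1) * \<psi> S *
     of_real (euler_phi (H0 ^ l div D ^ (l - 1))) * of_nat (euler_phi_tuples l (H div H0)) *
     (\<Sum>M | lead_coeff M = 1 \<and> D dvd M \<and> M dvd H \<and> (\<forall>i\<in>{1..s}. H div M dvd W i).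
        dirichlet_conv moebius F M / of_real (euler_phi M) * of_real (poly_norm (H div M)) ^ s)"
proof -
  obtain H1 where H1: "H = H0 * H1" using assms(10) by (elim dvdE)
  have H1_eq: "H div H0 = H1" using assms(1) by (simp add: H1)
  have "dirichlet_character D \<psi>" using assms(5) by (simp add: primitive_character_def)
  moreover have "coprime H0 H1" using assms(12) by (simp only: H1_eq)
  ultimately interpret character_with_conductor H D H0 H1 \<chi> \<psi>
    using assms(1,3,4,6,11) H1 by (intro character_with_conductor.intro)
  define n where "n = l - 1"
  have l: "l = Suc n" using assms(2) by (simp add: n_def)
  let ?Dv = "{M. lead_coeff M = 1 \<and> M dvd H}"
  let ?w = "\<lambda>M. if \<forall>i\<in>{1..s}. H div M dvd W i
              then dirichlet_conv moebius F M * of_real (poly_norm (H div M)) ^ s else 0"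
  let ?c = "(moebius D * of_real (poly_norm (H0 div D))) ^ n"
  let ?u = "unit_conv H1 (coprime_indicator H1) n"
  \<comment> \<open>The value of the sum over the additive variables when the \<open>K i\<close> add
    up to \<open>A\<close>, without the factor \<open>\<chi> (K 1)\<close>.\<close>
  define g where "g = (\<lambda>A. \<Sum>M\<in>?Dv. if M dvd A - S then ?w M else 0)"
  have fin: "finite ?Dv" using H_nz by simp
  have g_periodic: "periodic_mod H g"
  proof (rule periodic_modI)
    fix A B assume AB: "[A = B] (mod H)"
    have "M dvd A - S \<longleftrightarrow> M dvd B - S" if "M \<in> ?Dv" for M
    proof -
      have "[A = B] (mod M)" using AB that by (auto intro: cong_dvd_modulus)
      thus ?thesis by (intro cong_dvd_iff cong_diff) auto
    qed
    thus "g A = g B" unfolding g_def by (intro sum.cong) auto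
  qed
  have "(\<Sum>B \<in> {1..s} \<rightarrow>\<^sub>E residue_reps H.
          F (Gcd ({X - S} \<union> B ` {1..s} \<union> {H})) * z * (\<Prod>i=1..s. additive_character (W i) H (B i))) =
        z * g X" for X z
  proof -
    have "g X = (\<Sum>M\<in>?Dv. if M dvd X - S \<and> (\<forall>i\<in>{1..s}. H div M dvd W i)
            then dirichlet_conv moebius F M * of_real (poly_norm (H div M)) ^ s else 0)"
      unfolding g_def by (intro sum.cong) auto
    also have "\<dots> = (\<Sum>B \<in> {1..s} \<rightarrow>\<^sub>E residue_reps H. F (Gcd ({X - S} \<union> B ` {1..s} \<union> {H})) *
            (\<Prod>i=1..s. additive_character (W i) H (B i)))"
      using H_nz by (rule sum_gcd_additive_characters [symmetric])
    finally show ?thesis by (simp only: sum_distrib_left mult_ac)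
  qed
  hence "(\<Sum>K \<in> {K \<in> {1..l} \<rightarrow>\<^sub>E residue_reps H.
                coprime (\<Sum>i=1..l. K i) H \<and> coprime (\<Prod>i=1..l. K i) H}.
        \<Sum>B \<in> {1..s} \<rightarrow>\<^sub>E residue_reps H.
          F (Gcd ({(\<Sum>i=1..l. K i) - S} \<union> B ` {1..s} \<union> {H})) * \<chi> (K 1) *
          (\<Prod>i=1..s. additive_character (W i) H (B i))) =
        (\<Sum>K \<in> {K \<in> {1..l} \<rightarrow>\<^sub>E residue_reps H.
                coprime (\<Sum>i=1..l. K i) H \<and> coprime (\<Prod>i=1..l. K i) H}. \<chi> (K 1) * g (\<Sum>i=1..l. K i))"
    by (simp only:)
  also have "\<dots> = (\<Sum>A\<in>residue_reps H. coprime_indicator H A * g A * unit_conv H \<chi> n A)"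
    unfolding n_def using H_nz assms(2) dirichlet_characterD[OF chi] g_periodic
    by (intro sum_unit_tuples) blast+
  \<comment> \<open>On units \<open>\<psi>\<close> agrees with \<open>\<chi>\<close> and the count
    \<open>?u\<close> is constant; off the units both sides are 0.\<close>
  also have "\<dots> = (\<Sum>A\<in>residue_reps H. ?c * ?u 1 * (\<chi> A * g A))"
  proof (intro sum.cong refl)
    fix A
    show "coprime_indicator H A * g A * unit_conv H \<chi> n A = ?c * ?u 1 * (\<chi> A * g A)"
    proof (cases "coprime A H")
      case True
      hence "?u A = ?u 1"
        using unit_conv_coprime_indicator_scale[of A H1 n 1] by (simp add: H_eq)
      thus ?thesis using True chi_eq_psi[OF True]
        by (simp add: unit_conv_chi coprime_indicator_def)
    next
      case False
      thus ?thesis using dirichlet_characterD(3)[OF chi, of A] by (simp add: coprime_indicator_def)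
    qed
  qed
  also have "\<dots> = ?c * ?u 1 * (\<Sum>M\<in>?Dv. ?w M * (\<Sum>A\<in>residue_reps H. if M dvd A - S then \<chi> A else 0))"
  proof -
    have "(\<Sum>A\<in>residue_reps H. \<chi> A * g A) =
          (\<Sum>A\<in>residue_reps H. \<Sum>M\<in>?Dv. ?w M * (if M dvd A - S then \<chi> A else 0))"
      unfolding g_def sum_distrib_left by (intro sum.cong refl) auto
    also have "\<dots> = (\<Sum>M\<in>?Dv. ?w M * (\<Sum>A\<in>residue_reps H. if M dvd A - S then \<chi> A else 0))"
      by (subst sum.swap) (simp only: sum_distrib_left)
    finally show ?thesis by (simp only: sum_distrib_left [symmetric])
  qed
  also have "(\<Sum>M\<in>?Dv. ?w M * (\<Sum>A\<in>residue_reps H. if M dvd A - S then \<chi> A else 0)) =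
        (\<Sum>M\<in>?Dv. if D dvd M \<and> (\<forall>i\<in>{1..s}. H div M dvd W i) then
           \<psi> S * of_real (euler_phi H) * (dirichlet_conv moebius F M / of_real (euler_phi M) *
             of_real (poly_norm (H div M)) ^ s) else 0)"
  proof (intro sum.cong refl)
    fix M assume M: "M \<in> ?Dv"
    have "(\<Sum>A\<in>residue_reps H. if M dvd A - S then \<chi> A else 0) =
          (if D dvd M then \<psi> S * of_real (euler_phi H / euler_phi M) else 0)"
      using M assms(8) by (intro sum_chi_class) auto
    thus "?w M * (\<Sum>A\<in>residue_reps H. if M dvd A - S then \<chi> A else 0) =
          (if D dvd M \<and> (\<forall>i\<in>{1..s}. H div M dvd W i) then
           \<psi> S * of_real (euler_phi H) * (dirichlet_conv moebius F M / of_real (euler_phi M) *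
             of_real (poly_norm (H div M)) ^ s) else 0)" by auto
  qed
  also have "\<dots> = (\<Sum>M\<in>{M\<in>?Dv. D dvd M \<and> (\<forall>i\<in>{1..s}. H div M dvd W i)}.
           \<psi> S * of_real (euler_phi H) * (dirichlet_conv moebius F M / of_real (euler_phi M) *
             of_real (poly_norm (H div M)) ^ s))"
    using fin by (rule sum.inter_filter [symmetric])
  also have "{M\<in>?Dv. D dvd M \<and> (\<forall>i\<in>{1..s}. H div M dvd W i)} =
     {M. lead_coeff M = 1 \<and> D dvd M \<and> M dvd H \<and> (\<forall>i\<in>{1..s}. H div M dvd W i)}" (is "_ = ?Ms") by auto
  also have "?c * ?u 1 * (\<Sum>M\<in>?Ms. \<psi> S * of_real (euler_phi H) *
               (dirichlet_conv moebius F M / of_real (euler_phi M) * of_real (poly_norm (H div M)) ^ s)) =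
             (?c * ?u 1 * of_real (euler_phi H)) * \<psi> S * (\<Sum>M\<in>?Ms.
                dirichlet_conv moebius F M / of_real (euler_phi M) * of_real (poly_norm (H div M)) ^ s)"
    by (simp only: sum_distrib_left [symmetric] mult_ac)
  \<comment> \<open>\<open>euler_phi H\<close> splits over \<open>H0\<close> and \<open>H1\<close>:
    the first factor absorbs the power of \<open>poly_norm (H0 div D)\<close>, the second turns
    \<open>?u 1\<close> into the number of tuples modulo \<open>H1\<close>.\<close>
  also have "?c * ?u 1 * of_real (euler_phi H) = moebius D ^ (l - 1) *
       of_real (euler_phi (H0 ^ l div D ^ (l - 1))) * of_nat (euler_phi_tuples l (H div H0))"
  proof -
    have "euler_phi H = euler_phi H0 * euler_phi H1"
      unfolding H_eq using H0_coprime by (intro euler_phi_coprime_mult) auto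
    moreover have "of_nat (euler_phi_tuples l (H div H0)) = of_real (euler_phi H1) * ?u 1"
      using euler_phi_tuples_eq[of H1 l] by (simp add: l H1_eq)
    moreover have "euler_phi (H0 ^ l div D ^ (l - 1)) = poly_norm (H0 div D) ^ n * euler_phi H0"
      using euler_phi_quotient[of n] by (simp add: l)
    ultimately show ?thesis by (simp add: l power_mult_distrib)
  qed
  finally show ?thesis by (simp only: mult_ac)
qed

end
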